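(* Let $n$ and $\Delta$ be positive integers such that $\Delta \ge \frac{2n-4}{3}$. Let $R$ be an $(n-1)$-vertex connected $\Delta$-regular simple graph of Class $1$, and let $G$ be an $n$-vertex graph obtained from $R$ by a vertex-splitting. Then $G$ is $\Delta$-critical.
   Context: All graphs are finite and simple. For a graph $G$, $\Delta(G)$ denotes its maximum degree. A $k$-edge-coloring of $G$ is a map $\varphi: E(G)\to\{1,\dots,k\}$ such that adjacent edges receive distinct colors; the chromatic index $\chi'(G)$ is the least $k$ for which a $k$-edge-coloring exists. By Vizing's theorem $\Delta(G)\le\chi'(G)\le\Delta(G)+1$; $G$ is of Class $1$ if $\chi'(G)=\Delta(G)$ and of Class $2$ otherwise. A graph $G$ is edge-chromatic critical if $\chi'(H)<\chi'(G)$ for every proper subgraph $H$ of $G$; $G$ is $\Delta$-critical if it is edge-chromatic critical and $\chi'(G)=\Delta+1$ where $\Delta=\Delta(G)$. A vertex-splitting of a graph $R$ at a vertex $v$ produces a new graph by replacing $v$ with two new adjacent vertices $v_1,v_2$ and partitioning $N_R(v)$ into two nonempty subsets which serve as the sets of neighbors of $v_1$ and of $v_2$, respectively, among the vertices of $R$ other than $v$. *)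

theory Defs
  imports Complex_Main
begin

record 'a ugraph =
  verts :: "'a set"
  edges :: "'a set set"

definition simple_graph :: "'a ugraph \<Rightarrow> bool" where
  "simple_graph G \<longleftrightarrow> finite (verts G) \<and> (\<forall>e\<in>edges G. e \<subseteq> verts G \<and> card e = 2)"

definition neighbors :: "'a ugraph \<Rightarrow> 'a \<Rightarrow> 'a set" where
  "neighbors G v = {u \<in> verts G. {v, u} \<in> edges G}"

definition degree :: "'a ugraph \<Rightarrow> 'a \<Rightarrow> nat" where
  "degree G v = card {e \<in> edges G. v \<in> e}"

text \<open>Inserting 0 only matters for the graph without vertices, which gets maximum degree 0.\<close>

definition max_degree :: "'a ugraph \<Rightarrow> nat" where
  "max_degree G = Max (insert 0 (degree G ` verts G))"

definition regular :: "nat \<Rightarrow> 'a ugraph \<Rightarrow> bool" where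
  "regular d G \<longleftrightarrow> (\<forall>v\<in>verts G. degree G v = d)"

definition connected_graph :: "'a ugraph \<Rightarrow> bool" where
  "connected_graph G \<longleftrightarrow> verts G \<noteq> {} \<and>
     (\<forall>u\<in>verts G. \<forall>w\<in>verts G. (u, w) \<in> {(x, y). {x, y} \<in> edges G}\<^sup>*)"

definition edge_coloring :: "'a ugraph \<Rightarrow> nat \<Rightarrow> ('a set \<Rightarrow> nat) \<Rightarrow> bool" where
  "edge_coloring G k \<phi> \<longleftrightarrow> (\<forall>e\<in>edges G. \<phi> e \<in> {1..k}) \<and>
     (\<forall>e\<in>edges G. \<forall>f\<in>edges G. e \<noteq> f \<and> e \<inter> f \<noteq> {} \<longrightarrow> \<phi> e \<noteq> \<phi> f)"

definition chromatic_index :: "'a ugraph \<Rightarrow> nat" where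
  "chromatic_index G = (LEAST k. \<exists>\<phi>. edge_coloring G k \<phi>)"

definition class1 :: "'a ugraph \<Rightarrow> bool" where
  "class1 G \<longleftrightarrow> chromatic_index G = max_degree G"

definition subgraph :: "'a ugraph \<Rightarrow> 'a ugraph \<Rightarrow> bool" where
  "subgraph H G \<longleftrightarrow> simple_graph H \<and> verts H \<subseteq> verts G \<and> edges H \<subseteq> edges G"

definition edge_chromatic_critical :: "'a ugraph \<Rightarrow> bool" where
  "edge_chromatic_critical G \<longleftrightarrow>
     (\<forall>H. subgraph H G \<and> H \<noteq> G \<longrightarrow> chromatic_index H < chromatic_index G)"

definition delta_critical :: "nat \<Rightarrow> 'a ugraph \<Rightarrow> bool" where
  "delta_critical d G \<longleftrightarrow>
     max_degree G = d \<and> edge_chromatic_critical G \<and> chromatic_index G = d + 1"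

definition vertex_splitting :: "'a ugraph \<Rightarrow> 'a \<Rightarrow> 'a ugraph \<Rightarrow> bool" where
  "vertex_splitting R v G \<longleftrightarrow> v \<in> verts R \<and>
     (\<exists>v1 v2 N1 N2.
        v1 \<notin> verts R \<and> v2 \<notin> verts R \<and> v1 \<noteq> v2 \<and>
        N1 \<union> N2 = neighbors R v \<and> N1 \<inter> N2 = {} \<and> N1 \<noteq> {} \<and> N2 \<noteq> {} \<and>
        verts G = (verts R - {v}) \<union> {v1, v2} \<and>
        edges G = {e \<in> edges R. v \<notin> e} \<union> {{v1, v2}}
                    \<union> {{v1, u} | u. u \<in> N1} \<union> {{v2, u} | u. u \<in> N2})"

end

theory Submission
  imports Defs
begin

text \<open>A Class 1 regular graph \<open>R\<close> has a 1-factorization, so \<open>R\<close> has an even number of vertices and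
  \<open>G\<close> has one edge too many for \<open>\<Delta>\<close> matchings; giving \<open>v1 v2\<close> a new colour shows
  \<open>\<chi>'(G) = \<Delta> + 1\<close>. It remains to colour \<open>G - e\<close> with \<open>\<Delta>\<close> colours for every edge \<open>e\<close>, starting from a
  1-factorization of \<open>R\<close> and using Kempe changes. If \<open>e\<close> meets \<open>v1\<close> or \<open>v2\<close>, the colour of \<open>e\<close>
  becomes free at both. Otherwise let \<open>e = x y\<close> be an edge of \<open>R - v\<close> and suppose that \<open>G - e\<close> is not
  \<open>\<Delta>\<close>-colourable.

  If \<open>v1\<close> and \<open>v2\<close> both have degree at least 3, then \<open>x\<close> is neither a neighbour of \<open>v\<close> nor adjacent
  to one, so the neighbourhoods of \<open>x\<close> and \<open>v\<close> are disjoint, which is impossible for \<open>\<Delta> \<ge> (2 n - 4) / 3\<close>.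

  If \<open>v2\<close> has degree 2, then \<open>G\<close> arises by subdividing an edge \<open>v b\<close> of \<open>R\<close>, and in every
  \<open>\<Delta>\<close>-colouring of \<open>R - v b - x y\<close> the vertices \<open>v\<close> and \<open>b\<close> miss the same colour. There are no edges
  between \<open>{v, b}\<close> and \<open>{x, y}\<close>, and the degree bound yields a common neighbour \<open>w\<close> of \<open>v\<close>, \<open>b\<close> and
  \<open>x\<close>. After uncolouring \<open>v w\<close>, \<open>b w\<close> and \<open>w x\<close>, at most three Kempe changes followed by a recolouring
  of these three edges make \<open>v\<close> and \<open>b\<close> miss different colours.\<close>

section \<open>Kempe chains\<close>

text \<open>Stated for bare edge sets because edges are removed and reinserted throughout, while the
  vertex set stays fixed.\<close>

definition proper_coloring :: "'a set set \<Rightarrow> nat \<Rightarrow> ('a set \<Rightarrow> nat) \<Rightarrow> bool" where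
  "proper_coloring E k \<phi> \<longleftrightarrow> (\<forall>e\<in>E. \<phi> e \<in> {1..k}) \<and>
     (\<forall>e\<in>E. \<forall>f\<in>E. e \<noteq> f \<and> e \<inter> f \<noteq> {} \<longrightarrow> \<phi> e \<noteq> \<phi> f)"

lemma edge_coloring_iff: "edge_coloring G k \<phi> \<longleftrightarrow> proper_coloring (edges G) k \<phi>"
  unfolding edge_coloring_def proper_coloring_def ..

lemma proper_coloringD:
  assumes "proper_coloring E k \<phi>" "e \<in> E" "f \<in> E" "u \<in> e" "u \<in> f" "\<phi> e = \<phi> f"
  shows "e = f"
  using assms unfolding proper_coloring_def by blast

lemma proper_coloring_range: "proper_coloring E k \<phi> \<Longrightarrow> e \<in> E \<Longrightarrow> \<phi> e \<in> {1..k}"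
  unfolding proper_coloring_def by blast

lemma proper_coloring_subset: "proper_coloring E k \<phi> \<Longrightarrow> F \<subseteq> E \<Longrightarrow> proper_coloring F k \<phi>"
  unfolding proper_coloring_def by blast

text \<open>Indexed by the colour rather than by the vertex: a Kempe change in two colours alters
  only the two corresponding sets.\<close>

definition missing :: "'a set \<Rightarrow> 'a set set \<Rightarrow> ('a set \<Rightarrow> nat) \<Rightarrow> nat \<Rightarrow> 'a set" where
  "missing V E \<phi> c = {u \<in> V. \<forall>e\<in>E. u \<in> e \<longrightarrow> \<phi> e \<noteq> c}"

lemma missing_disjoint_edge:
  "u \<in> missing V E \<phi> c \<Longrightarrow> e \<in> E \<Longrightarrow> u \<in> e \<Longrightarrow> \<phi> e \<noteq> c"
  unfolding missing_def by blast

lemma proper_coloring_insert: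
  assumes "proper_coloring E k \<phi>" "{u, w} \<notin> E" "c \<in> {1..k}"
    and "\<And>e. e \<in> E \<Longrightarrow> u \<in> e \<or> w \<in> e \<Longrightarrow> \<phi> e \<noteq> c"
  shows "proper_coloring (insert {u, w} E) k (\<phi>({u, w} := c))"
  unfolding proper_coloring_def
proof (intro conjI ballI impI)
  fix e assume "e \<in> insert {u, w} E"
  then show "(\<phi>({u, w} := c)) e \<in> {1..k}"
    using assms(1,3) unfolding proper_coloring_def by auto
next
  fix e f assume e: "e \<in> insert {u, w} E" and f: "f \<in> insert {u, w} E"
    and ef: "e \<noteq> f \<and> e \<inter> f \<noteq> {}"
  show "(\<phi>({u, w} := c)) e \<noteq> (\<phi>({u, w} := c)) f"
  proof (cases "e = {u, w} \<or> f = {u, w}")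
    case True
    then consider "e = {u, w}" "f \<in> E" "f \<noteq> {u, w}" "u \<in> f \<or> w \<in> f"
      | "f = {u, w}" "e \<in> E" "e \<noteq> {u, w}" "u \<in> e \<or> w \<in> e"
      using e f ef by auto
    then show ?thesis using assms(4) by cases auto
  next
    case False
    then show ?thesis using e f ef assms(1) unfolding proper_coloring_def by auto
  qed
qed

section \<open>Counting in matchings and in connected edge sets\<close>

lemma card_Union_matching:
  assumes "\<And>e. e \<in> M \<Longrightarrow> card e = 2"
    and "\<And>e f. e \<in> M \<Longrightarrow> f \<in> M \<Longrightarrow> e \<noteq> f \<Longrightarrow> e \<inter> f = {}"
  shows "card (\<Union>M) = 2 * card M"
proof -
  have "card (\<Union>M) = sum card M"
    using assms by (intro card_Union_disjoint)
      (auto simp: pairwise_def disjnt_def intro: card_ge_0_finite)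
  also have "\<dots> = 2 * card M" using assms(1) by simp
  finally show ?thesis .
qed

text \<open>The spanning tree bound, obtained without trees: among the sets \<open>S\<close> inside
  \<open>C\<close> that contain \<open>u\<close> and span at least \<open>card S - 1\<close> edges,
  take a maximal one. If it were not \<open>C\<close>, some edge would leave it, and the outer end
  of that edge could be added.\<close>

lemma card_reachable_le:
  assumes "finite F" and C: "C = {(x, y). {x, y} \<in> F}\<^sup>* `` {u}" and "finite C"
  shows "card C \<le> card {e \<in> F. e \<subseteq> C} + 1"
proof -
  define P where "P S \<longleftrightarrow> u \<in> S \<and> S \<subseteq> C \<and> card S \<le> card {e \<in> F. e \<subseteq> S} + 1" for S
  have "P {u}" unfolding P_def C by auto
  moreover have "finite {S. P S}"
    by (rule finite_subset[of _ "Pow C"]) (auto simp: P_def \<open>finite C\<close>)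
  ultimately obtain S where S: "P S" and mx: "\<And>T. P T \<Longrightarrow> S \<subseteq> T \<Longrightarrow> T = S"
    using finite_has_maximal[of "{S. P S}"] by blast
  have "S = C"
  proof (rule ccontr)
    assume "S \<noteq> C"
    have "\<exists>x\<in>S. \<exists>y. y \<notin> S \<and> {x, y} \<in> F"
    proof (rule ccontr)
      assume no: "\<not> ?thesis"
      have "y \<in> S" if "(u, y) \<in> {(x, y). {x, y} \<in> F}\<^sup>*" for y
        using that
      proof (induction rule: rtrancl_induct)
        case base
        then show ?case using S by (simp add: P_def)
      next
        case (step y z)
        then show ?case using no by auto
      qed
      then have "C \<subseteq> S" unfolding C by auto
      then show False using S \<open>S \<noteq> C\<close> by (auto simp: P_def)
    qed
    then obtain x y where xy: "x \<in> S" "y \<notin> S" "{x, y} \<in> F" by blast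
    have "x \<in> C" using xy S by (auto simp: P_def)
    then have "y \<in> C" unfolding C using xy(3) by (auto intro: rtrancl_into_rtrancl)
    have "finite S" using S \<open>finite C\<close> by (auto simp: P_def intro: finite_subset)
    have "insert {x, y} {e \<in> F. e \<subseteq> S} \<subseteq> {e \<in> F. e \<subseteq> insert y S}" using xy by auto
    then have "card (insert {x, y} {e \<in> F. e \<subseteq> S}) \<le> card {e \<in> F. e \<subseteq> insert y S}"
      using \<open>finite F\<close> by (intro card_mono) auto
    moreover have "card (insert {x, y} {e \<in> F. e \<subseteq> S}) = Suc (card {e \<in> F. e \<subseteq> S})"
      using \<open>finite F\<close> xy(2) by (subst card_insert_disjoint) auto
    moreover have "card (insert y S) = Suc (card S)" using \<open>finite S\<close> xy(2) by simp
    ultimately have "P (insert y S)" using S \<open>y \<in> C\<close> by (auto simp: P_def)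
    then have "insert y S = S" using mx by blast
    then show False using xy(2) by blast
  qed
  then show ?thesis using S by (simp add: P_def)
qed

section \<open>Bichromatic components and the exchange of their colours\<close>

definition kempe_component ::
    "'a set set \<Rightarrow> ('a set \<Rightarrow> nat) \<Rightarrow> nat \<Rightarrow> nat \<Rightarrow> 'a \<Rightarrow> 'a set" where
  "kempe_component E \<phi> p q u = {(x, y). {x, y} \<in> {e \<in> E. \<phi> e \<in> {p, q}}}\<^sup>* `` {u}"

text \<open>Meeting \<open>C\<close> suffices as a test when \<open>C\<close> is a component in the
  colours \<open>p\<close>, \<open>q\<close>: by \<open>comp_closed\<close> an edge of
  \<open>E\<close> in one of these colours that meets \<open>C\<close> lies inside it.\<close>

definition kempe_swap ::
    "nat \<Rightarrow> nat \<Rightarrow> 'a set \<Rightarrow> ('a set \<Rightarrow> nat) \<Rightarrow> 'a set \<Rightarrow> nat" where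
  "kempe_swap p q C \<phi> e =
     (if e \<inter> C \<noteq> {} then if \<phi> e = p then q else if \<phi> e = q then p else \<phi> e else \<phi> e)"

lemma kempe_component_refl [simp]: "u \<in> kempe_component E \<phi> p q u"
  unfolding kempe_component_def by auto

lemma kempe_component_sym:
  assumes "t \<in> kempe_component E \<phi> p q u"
  shows "kempe_component E \<phi> p q t = kempe_component E \<phi> p q u"
proof -
  let ?r = "{(x, y). {x, y} \<in> {e \<in> E. \<phi> e \<in> {p, q}}}"
  have "sym ?r" by (auto simp: sym_def insert_commute)
  then have s: "sym (?r\<^sup>*)" by (rule sym_rtrancl)
  have "(u, t) \<in> ?r\<^sup>*" using assms unfolding kempe_component_def by auto
  moreover have "(t, u) \<in> ?r\<^sup>*" using calculation s by (auto dest: symD)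
  ultimately show ?thesis unfolding kempe_component_def by (auto intro: rtrancl_trans)
qed

text \<open>An exchange only permutes \<open>p\<close> and \<open>q\<close>, so for such pairs the
  set of edges coloured from \<open>{r, s}\<close> does not change. Links in one pair of colours
  therefore survive an exchange in a disjoint pair.\<close>

lemma kempe_component_swap:
  assumes "{r, s} = {p, q} \<or> {r, s} \<inter> {p, q} = {}"
  shows "kempe_component E (kempe_swap p q C \<phi>) r s u = kempe_component E \<phi> r s u"
proof -
  have "kempe_swap p q C \<phi> e \<in> {r, s} \<longleftrightarrow> \<phi> e \<in> {r, s}" for e
    using assms unfolding kempe_swap_def by auto
  then show ?thesis unfolding kempe_component_def by simp
qed

locale edge_set =
  fixes V :: "'a set" and E :: "'a set set"
  assumes finite_V: "finite V"
    and edge_sub: "e \<in> E \<Longrightarrow> e \<subseteq> V"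
    and edge_card: "e \<in> E \<Longrightarrow> card e = 2"
begin

abbreviation "mis \<equiv> missing V E"
abbreviation "kcomp \<equiv> kempe_component E"

lemma finite_E: "finite E"
  using finite_subset[of E "Pow V"] edge_sub finite_V by blast

lemma comp_closed:
  assumes "e \<in> E" "\<phi> e \<in> {p, q}" "e \<inter> kcomp \<phi> p q u \<noteq> {}"
  shows "e \<subseteq> kcomp \<phi> p q u"
proof -
  obtain s t where e: "e = {s, t}" using edge_card[OF assms(1)] by (auto simp: card_2_iff)
  have "z \<in> kcomp \<phi> p q u" if "y \<in> kcomp \<phi> p q u" "{y, z} = e" for y z
    using that assms(1,2) unfolding kempe_component_def
    by (auto intro: rtrancl_into_rtrancl)
  then show ?thesis using assms(3) e by (auto simp: insert_commute)
qed

lemma comp_sub_V: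
  assumes "u \<in> V" shows "kcomp \<phi> p q u \<subseteq> V"
proof -
  have "t \<in> V" if "(u, t) \<in> {(x, y). {x, y} \<in> {e \<in> E. \<phi> e \<in> {p, q}}}\<^sup>*" for t
    using that assms by (induction rule: rtrancl_induct) (use edge_sub in auto)
  then show ?thesis unfolding kempe_component_def by auto
qed

text \<open>The edges of colour \<open>c\<close> inside \<open>U\<close> form a matching that covers
  exactly the vertices of \<open>U\<close> at which \<open>c\<close> is present. With
  \<open>U\<close> a Kempe component this controls the number of ends; with \<open>U\<close> the
  whole vertex set it gives parity.\<close>

lemma card_covered:
  assumes "proper_coloring E k \<phi>" and U: "U \<subseteq> V"
    and closed: "\<And>e. e \<in> E \<Longrightarrow> \<phi> e = c \<Longrightarrow> e \<inter> U \<noteq> {} \<Longrightarrow> e \<subseteq> U"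
  shows "card U = 2 * card {e \<in> E. \<phi> e = c \<and> e \<subseteq> U} + card (U \<inter> mis \<phi> c)"
proof -
  let ?M = "{e \<in> E. \<phi> e = c \<and> e \<subseteq> U}"
  have "card (\<Union>?M) = 2 * card ?M"
    using assms(1) by (intro card_Union_matching) (auto simp: edge_card dest: proper_coloringD)
  moreover have "U = \<Union>?M \<union> (U \<inter> mis \<phi> c)" using U closed unfolding missing_def by blast
  moreover have "\<Union>?M \<inter> (U \<inter> mis \<phi> c) = {}" unfolding missing_def by blast
  moreover have "finite U" using U finite_V finite_subset by blast
  ultimately show ?thesis by (metis card_Un_disjoint finite_Un)
qed

text \<open>A bichromatic component is connected, so it has at least \<open>card C - 1\<close> edges, while it
  covers each vertex by at most one edge of each colour; comparing the two counts leaves exactly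
  two ends.\<close>

lemma kempe_two_ends:
  assumes proper: "proper_coloring E k \<phi>" and pq: "p \<noteq> q" and u: "u \<in> V"
    and D: "D = (mis \<phi> p - mis \<phi> q) \<union> (mis \<phi> q - mis \<phi> p)" and uD: "u \<in> D"
  shows "\<exists>t. t \<noteq> u \<and> D \<inter> kcomp \<phi> p q u = {u, t}"
proof -
  let ?C = "kcomp \<phi> p q u"
  have CV: "?C \<subseteq> V" using comp_sub_V u by blast
  then have fC: "finite ?C" using finite_V finite_subset by blast
  let ?ep = "{e \<in> E. \<phi> e = p \<and> e \<subseteq> ?C}" and ?eq = "{e \<in> E. \<phi> e = q \<and> e \<subseteq> ?C}"
  have 1: "card ?C = 2 * card ?ep + card (?C \<inter> mis \<phi> p)"
    by (rule card_covered[OF proper CV]) (use comp_closed[of _ \<phi> p q u] in blast)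
  have 2: "card ?C = 2 * card ?eq + card (?C \<inter> mis \<phi> q)"
    by (rule card_covered[OF proper CV]) (use comp_closed[of _ \<phi> p q u] in blast)
  have "card ?C \<le> card {e \<in> {e \<in> E. \<phi> e \<in> {p, q}}. e \<subseteq> ?C} + 1"
    by (rule card_reachable_le[OF _ _ fC]) (auto simp: finite_E kempe_component_def)
  also have "{e \<in> {e \<in> E. \<phi> e \<in> {p, q}}. e \<subseteq> ?C} = ?ep \<union> ?eq" by auto
  also have "card (?ep \<union> ?eq) = card ?ep + card ?eq"
    using pq finite_E by (intro card_Un_disjoint) auto
  \<comment> \<open>Adding \<open>1\<close> and \<open>2\<close> expresses
    \<open>2 * card ?C\<close> as twice the number of edges plus the two missing counts, and there
    are at least \<open>card ?C - 1\<close> edges.\<close>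
  finally have 3: "card (?C \<inter> mis \<phi> p) + card (?C \<inter> mis \<phi> q) \<le> 2" using 1 2 by linarith
  have 4: "even (card (?C \<inter> mis \<phi> p) + card (?C \<inter> mis \<phi> q))"
  proof -
    have "even (a + b)" if "n = 2 * s + a" "n = 2 * t + b" for a b n s t :: nat
      using that by presburger
    then show ?thesis using 1 2 by blast
  qed
  \<comment> \<open>Vertices missing both colours are counted twice and do not lie in
    \<open>D\<close>; hence the number of ends is even, positive and at most 2.\<close>
  let ?B = "?C \<inter> (mis \<phi> p \<inter> mis \<phi> q)"
  have 5: "card (?C \<inter> mis \<phi> p) + card (?C \<inter> mis \<phi> q) = card (D \<inter> ?C) + 2 * card ?B"
  proof -
    have "card (?C \<inter> mis \<phi> p) = card ?B + card (?C \<inter> (mis \<phi> p - mis \<phi> q))"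
      using card_Int_Diff[of "?C \<inter> mis \<phi> p" "mis \<phi> q"] fC by (simp add: Int_assoc Int_Diff)
    moreover have "card (?C \<inter> mis \<phi> q) = card ?B + card (?C \<inter> (mis \<phi> q - mis \<phi> p))"
      using card_Int_Diff[of "?C \<inter> mis \<phi> q" "mis \<phi> p"] fC
      by (simp add: Int_assoc Int_Diff Int_commute[of "mis \<phi> q"])
    moreover have "D \<inter> ?C = (?C \<inter> (mis \<phi> p - mis \<phi> q)) \<union> (?C \<inter> (mis \<phi> q - mis \<phi> p))"
      unfolding D by blast
    moreover have "card \<dots> = card (?C \<inter> (mis \<phi> p - mis \<phi> q)) + card (?C \<inter> (mis \<phi> q - mis \<phi> p))"
      using fC by (intro card_Un_disjoint) auto
    ultimately show ?thesis by simp
  qed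
  have "u \<in> D \<inter> ?C" using uD by simp
  then have "card (D \<inter> ?C) > 0" using fC by (auto simp: card_gt_0_iff)
  moreover have "d = 2" if "n \<le> 2" "even n" "n = d + 2 * b" "d > 0" for n d b :: nat
    using that by presburger
  ultimately have "card (D \<inter> ?C) = 2" using 3 4 5 by blast
  then obtain s t where "D \<inter> ?C = {s, t}" "s \<noteq> t" unfolding card_2_iff by blast
  then show ?thesis using \<open>u \<in> D \<inter> ?C\<close> by (metis empty_iff insert_commute insert_iff)
qed

lemma kempe_swap_proper:
  assumes proper: "proper_coloring E k \<phi>" and "p \<in> {1..k}" "q \<in> {1..k}"
  shows "proper_coloring E k (kempe_swap p q (kcomp \<phi> p q u) \<phi>)"
  unfolding proper_coloring_def
proof (intro conjI ballI impI)
  fix e assume "e \<in> E"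
  then show "kempe_swap p q (kcomp \<phi> p q u) \<phi> e \<in> {1..k}"
    using assms proper_coloring_range unfolding kempe_swap_def by auto
next
  fix e f assume e: "e \<in> E" "f \<in> E" and ef: "e \<noteq> f \<and> e \<inter> f \<noteq> {}"
  let ?C = "kcomp \<phi> p q u"
  have ne: "\<phi> e \<noteq> \<phi> f" using proper e ef unfolding proper_coloring_def by blast
  have "e \<inter> ?C \<noteq> {} \<longleftrightarrow> f \<inter> ?C \<noteq> {}" if "\<phi> e \<in> {p, q}" "\<phi> f \<in> {p, q}"
    using comp_closed[of e \<phi> p q u] comp_closed[of f \<phi> p q u] e that ef by blast
  then show "kempe_swap p q ?C \<phi> e \<noteq> kempe_swap p q ?C \<phi> f"
    using ne unfolding kempe_swap_def by auto
qed

lemma kempe_swap_missing_other: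
  "c \<notin> {p, q} \<Longrightarrow> mis (kempe_swap p q C \<phi>) c = mis \<phi> c"
  unfolding missing_def kempe_swap_def by auto

lemma kempe_swap_missing:
  assumes "p \<noteq> q"
  shows "mis (kempe_swap p q (kcomp \<phi> p q u) \<phi>) p =
    (mis \<phi> p - kcomp \<phi> p q u) \<union> (mis \<phi> q \<inter> kcomp \<phi> p q u)"
    and "mis (kempe_swap p q (kcomp \<phi> p q u) \<phi>) q =
    (mis \<phi> q - kcomp \<phi> p q u) \<union> (mis \<phi> p \<inter> kcomp \<phi> p q u)"
proof -
  let ?C = "kcomp \<phi> p q u"
  \<comment> \<open>For \<open>c\<close> in \<open>{p, q}\<close> the value \<open>p + q - c\<close>
    is the other of the two colours.\<close>
  have *: "(\<forall>e\<in>E. t \<in> e \<longrightarrow> kempe_swap p q ?C \<phi> e \<noteq> c) \<longleftrightarrow>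
      (\<forall>e\<in>E. t \<in> e \<longrightarrow> \<phi> e \<noteq> (if t \<in> ?C then p + q - c else c))" if "c \<in> {p, q}" for c t
  proof (intro ball_cong refl imp_cong)
    fix e assume e: "e \<in> E" "t \<in> e"
    have "e \<inter> ?C \<noteq> {} \<longleftrightarrow> t \<in> ?C" if "\<phi> e \<in> {p, q}"
      using comp_closed[of e \<phi> p q u] e that by blast
    then show "(kempe_swap p q ?C \<phi> e \<noteq> c) = (\<phi> e \<noteq> (if t \<in> ?C then p + q - c else c))"
      using that assms e(2) unfolding kempe_swap_def by auto
  qed
  show "mis (kempe_swap p q ?C \<phi>) p = (mis \<phi> p - ?C) \<union> (mis \<phi> q \<inter> ?C)"
    unfolding missing_def using *[of p] by auto
  show "mis (kempe_swap p q ?C \<phi>) q = (mis \<phi> q - ?C) \<union> (mis \<phi> p \<inter> ?C)"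
    unfolding missing_def using *[of q] by auto
qed

text \<open>The chain through \<open>u\<close> has exactly one further end by
  \<open>kempe_two_ends\<close>, so \<open>t\<close> is that end, and the exchange toggles just
  \<open>u\<close> and \<open>t\<close>. The other conclusions record what survives: the remaining
  colours, chains in the same or in a disjoint pair of colours, and edges off the chain.\<close>

lemma kempe_exchange:
  assumes proper: "proper_coloring E k \<phi>" and pq: "p \<noteq> q" and k: "p \<in> {1..k}" "q \<in> {1..k}"
    and D: "(mis \<phi> p - mis \<phi> q) \<union> (mis \<phi> q - mis \<phi> p) = D"
    and uD: "u \<in> D" and t: "t \<in> D" "t \<noteq> u" "t \<in> kcomp \<phi> p q u"
  obtains \<psi> where "proper_coloring E k \<psi>"
    and "mis \<psi> p = (mis \<phi> p - {u, t}) \<union> ({u, t} - mis \<phi> p)"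
    and "mis \<psi> q = (mis \<phi> q - {u, t}) \<union> ({u, t} - mis \<phi> q)"
    and "\<And>c. c \<notin> {p, q} \<Longrightarrow> mis \<psi> c = mis \<phi> c"
    and "\<And>r s. {r, s} = {p, q} \<or> {r, s} \<inter> {p, q} = {} \<Longrightarrow> kcomp \<psi> r s = kcomp \<phi> r s"
    and "\<And>e. \<phi> e \<notin> {p, q} \<Longrightarrow> \<psi> e = \<phi> e"
    and "\<And>e. e \<inter> kcomp \<phi> p q u = {} \<Longrightarrow> \<psi> e = \<phi> e"
    and "\<And>e. \<phi> e \<in> {p, q} \<Longrightarrow> \<psi> e \<in> {p, q}"
proof -
  let ?C = "kcomp \<phi> p q u"
  let ?\<psi> = "kempe_swap p q ?C \<phi>"
  have "u \<in> V" using uD D unfolding missing_def by blast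
  from kempe_two_ends[OF proper pq this D[symmetric] uD] have DC: "D \<inter> ?C = {u, t}"
    using t by auto
  have DC': "x \<in> ?C \<and> ((x \<in> mis \<phi> p) \<noteq> (x \<in> mis \<phi> q)) \<longleftrightarrow> x = u \<or> x = t" for x
    using DC D by blast
  show thesis
  proof
    show "proper_coloring E k ?\<psi>" using kempe_swap_proper[OF proper k] .
    show "mis ?\<psi> p = (mis \<phi> p - {u, t}) \<union> ({u, t} - mis \<phi> p)"
      unfolding kempe_swap_missing(1)[OF pq] using DC' by blast
    show "mis ?\<psi> q = (mis \<phi> q - {u, t}) \<union> ({u, t} - mis \<phi> q)"
      unfolding kempe_swap_missing(2)[OF pq] using DC' by blast
    show "mis ?\<psi> c = mis \<phi> c" if "c \<notin> {p, q}" for c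
      using kempe_swap_missing_other[OF that] .
    show "kcomp ?\<psi> r s = kcomp \<phi> r s" if "{r, s} = {p, q} \<or> {r, s} \<inter> {p, q} = {}" for r s
      by (rule ext) (rule kempe_component_swap[OF that])
    show "?\<psi> e = \<phi> e" if "\<phi> e \<notin> {p, q}" for e
      using that unfolding kempe_swap_def by auto
    show "?\<psi> e = \<phi> e" if "e \<inter> ?C = {}" for e
      using that unfolding kempe_swap_def by auto
    show "?\<psi> e \<in> {p, q}" if "\<phi> e \<in> {p, q}" for e
      using that unfolding kempe_swap_def by auto
  qed
qed

text \<open>Each chain has exactly two ends, so four ends lie on two disjoint chains, and
  \<open>s\<close> is linked to one of the other three.\<close>

lemma kempe_pairing:
  assumes proper: "proper_coloring E k \<phi>" and pq: "p \<noteq> q"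
    and D: "(mis \<phi> p - mis \<phi> q) \<union> (mis \<phi> q - mis \<phi> p) = {s, t, u, w}"
    and dist: "distinct [s, t, u, w]"
  obtains "t \<in> kcomp \<phi> p q s" "w \<in> kcomp \<phi> p q u" "kcomp \<phi> p q s \<inter> kcomp \<phi> p q u = {}"
  | "u \<in> kcomp \<phi> p q s" "w \<in> kcomp \<phi> p q t" "kcomp \<phi> p q s \<inter> kcomp \<phi> p q t = {}"
  | "w \<in> kcomp \<phi> p q s" "u \<in> kcomp \<phi> p q t" "kcomp \<phi> p q s \<inter> kcomp \<phi> p q t = {}"
proof -
  let ?D = "{s, t, u, w}"
  have ends: "\<exists>z. z \<noteq> y \<and> ?D \<inter> kcomp \<phi> p q y = {y, z}" if "y \<in> ?D" for y
  proof -
    have "y \<in> V" using that D unfolding missing_def by blast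
    then show ?thesis using kempe_two_ends[OF proper pq _ D[symmetric] that] by blast
  qed
  have disj: "kcomp \<phi> p q y \<inter> kcomp \<phi> p q z = {}" if "z \<notin> kcomp \<phi> p q y" for y z
    using that kempe_component_sym kempe_component_refl by (metis disjoint_iff)
  have sym: "z \<in> kcomp \<phi> p q y \<longleftrightarrow> y \<in> kcomp \<phi> p q z" for y z
    using kempe_component_sym kempe_component_refl by metis
  obtain z where z: "z \<noteq> s" "?D \<inter> kcomp \<phi> p q s = {s, z}" using ends[of s] by auto
  obtain t' where t': "t' \<noteq> t" "?D \<inter> kcomp \<phi> p q t = {t, t'}" using ends[of t] by auto
  obtain u' where u': "u' \<noteq> u" "?D \<inter> kcomp \<phi> p q u = {u, u'}" using ends[of u] by auto
  have "z \<in> ?D" using z by blast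
  then consider "z = t" | "z = u" | "z = w" using z by auto
  then show thesis
  proof cases
    case 1
    have "t \<in> kcomp \<phi> p q s" "u \<notin> kcomp \<phi> p q s" using z 1 dist by auto
    moreover have "w \<in> kcomp \<phi> p q u"
    proof -
      have "u' \<noteq> s" using sym[of u s] calculation(2) u' by blast
      moreover have "t \<notin> kcomp \<phi> p q u"
        using kempe_component_sym[of t E \<phi> p q s] kempe_component_sym[of t E \<phi> p q u]
          \<open>t \<in> kcomp \<phi> p q s\<close> \<open>u \<notin> kcomp \<phi> p q s\<close> by auto
      ultimately show ?thesis using u' by blast
    qed
    ultimately show thesis using that(1) disj by blast
  next
    case 2
    have "u \<in> kcomp \<phi> p q s" "t \<notin> kcomp \<phi> p q s" using z 2 dist by auto
    moreover have "w \<in> kcomp \<phi> p q t"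
    proof -
      have "t' \<noteq> s" using sym[of t s] calculation(2) t' by blast
      moreover have "u \<notin> kcomp \<phi> p q t"
        using kempe_component_sym[of u E \<phi> p q s] kempe_component_sym[of u E \<phi> p q t]
          \<open>u \<in> kcomp \<phi> p q s\<close> \<open>t \<notin> kcomp \<phi> p q s\<close> by auto
      ultimately show ?thesis using t' by blast
    qed
    ultimately show thesis using that(2) disj by blast
  next
    case 3
    have "w \<in> kcomp \<phi> p q s" "t \<notin> kcomp \<phi> p q s" using z 3 dist by auto
    moreover have "u \<in> kcomp \<phi> p q t"
    proof -
      have "t' \<noteq> s" using sym[of t s] calculation(2) t' by blast
      moreover have "w \<notin> kcomp \<phi> p q t"
        using kempe_component_sym[of w E \<phi> p q s] kempe_component_sym[of w E \<phi> p q t]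
          \<open>w \<in> kcomp \<phi> p q s\<close> \<open>t \<notin> kcomp \<phi> p q s\<close> by auto
      ultimately show ?thesis using t' by blast
    qed
    ultimately show thesis using that(3) disj by blast
  qed
qed

text \<open>A form of \<open>kempe_exchange\<close> with four missing sets written out, so that a
  sequence of exchanges in four colours can be followed by computing with explicit finite
  sets.\<close>

lemma kempe_step:
  assumes "proper_coloring E k \<phi>"
    and "mis \<phi> p = P" "mis \<phi> q = Q" "mis \<phi> r = R" "mis \<phi> s = S"
    and "t \<in> kcomp \<phi> p q u" "distinct [p, q, r, s]" "p \<in> {1..k}" "q \<in> {1..k}"
    and "t \<noteq> u" "u \<in> (P - Q) \<union> (Q - P)" "t \<in> (P - Q) \<union> (Q - P)"
    and "(P - {u, t}) \<union> ({u, t} - P) = P'" "(Q - {u, t}) \<union> ({u, t} - Q) = Q'"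
  shows "\<exists>\<psi>. proper_coloring E k \<psi> \<and> mis \<psi> p = P' \<and> mis \<psi> q = Q' \<and>
    mis \<psi> r = R \<and> mis \<psi> s = S \<and> kcomp \<psi> r s = kcomp \<phi> r s"
proof -
  have D: "(mis \<phi> p - mis \<phi> q) \<union> (mis \<phi> q - mis \<phi> p) = (P - Q) \<union> (Q - P)"
    using assms by simp
  have pq: "p \<noteq> q" using assms(7) by simp
  show ?thesis
  proof (rule kempe_exchange[OF assms(1) pq assms(8,9) D assms(11,12,10,6)])
    fix \<psi> assume 1: "proper_coloring E k \<psi>"
      "mis \<psi> p = (mis \<phi> p - {u, t}) \<union> ({u, t} - mis \<phi> p)"
      "mis \<psi> q = (mis \<phi> q - {u, t}) \<union> ({u, t} - mis \<phi> q)"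
      and 2: "\<And>c. c \<notin> {p, q} \<Longrightarrow> mis \<psi> c = mis \<phi> c"
      and 3: "\<And>r s. {r, s} = {p, q} \<or> {r, s} \<inter> {p, q} = {} \<Longrightarrow> kcomp \<psi> r s = kcomp \<phi> r s"
    have "mis \<psi> r = R" "mis \<psi> s = S" "kcomp \<psi> r s = kcomp \<phi> r s"
      using 2[of r] 2[of s] 3[of r s] assms by auto
    then show ?thesis using 1 assms by blast
  qed
qed

text \<open>Here \<open>E\<close> is the edge set left after uncolouring the edges \<open>a b\<close>, \<open>x y\<close>, \<open>a w\<close>, \<open>b w\<close>, \<open>w x\<close>.
  Exchanging a chain from \<open>u\<close> to \<open>t\<close> in colours \<open>p\<close>, \<open>q\<close> toggles \<open>u\<close> and \<open>t\<close> in the sets of vertices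
  missing \<open>p\<close> and \<open>q\<close>, and it preserves all chains in two other colours. The proof follows these four
  sets; the last hypothesis says that the three edges at \<open>w\<close> can never be recoloured such that
  distinct missing colours \<open>s\<close>, \<open>t\<close> remain at \<open>a\<close> and \<open>b\<close>.\<close>

lemma no_short_kite:
  assumes proper: "proper_coloring E k \<phi>" and dist: "distinct [a, b, x, y, w]"
    and c: "distinct [c0, c1, c2, c3]" "{c0, c1, c2, c3} \<subseteq> {1..k}"
    and m0: "mis \<phi> c0 = {a, b, x, y}" and m1: "mis \<phi> c1 = {a, w}"
    and m2: "mis \<phi> c2 = {b, w}" and m3: "mis \<phi> c3 = {x, w}"
    and no: "\<And>\<psi> p q r s t. \<lbrakk>proper_coloring E k \<psi>; {p, q, r, s, t} \<subseteq> {1..k};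
      distinct [p, q, r]; s \<noteq> p; t \<noteq> q; s \<noteq> t; {a, w} \<subseteq> mis \<psi> p; {b, w} \<subseteq> mis \<psi> q;
      {w, x} \<subseteq> mis \<psi> r; a \<in> mis \<psi> s; b \<in> mis \<psi> t\<rbrakk> \<Longrightarrow> False"
  shows False
proof -
  have cs: "c0 \<noteq> c1" "c0 \<noteq> c2" "c0 \<noteq> c3" "c1 \<noteq> c2" using c by auto
  have ds: "distinct [b, w, x, y]" "distinct [a, b, w, x]" "distinct [a, b, x, y]"
    "distinct [a, b, w, y]"
    using dist by auto
  have D1: "(mis \<phi> c0 - mis \<phi> c1) \<union> (mis \<phi> c1 - mis \<phi> c0) = {b, w, x, y}"
    using m0 m1 dist by auto
  consider "w \<in> kcomp \<phi> c0 c1 b" "y \<in> kcomp \<phi> c0 c1 x"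
    | "x \<in> kcomp \<phi> c0 c1 b" "y \<in> kcomp \<phi> c0 c1 w"
    | "y \<in> kcomp \<phi> c0 c1 b" "x \<in> kcomp \<phi> c0 c1 w"
    by (rule kempe_pairing[OF proper cs(1) D1 ds(1)])
  \<comment> \<open>If \<open>b\<close> were linked to \<open>x\<close> or \<open>y\<close>, an
    exchange would make \<open>b\<close> miss \<open>c1\<close>. Giving \<open>a w\<close>,
    \<open>b w\<close>, \<open>w x\<close> the colours \<open>c1\<close>, \<open>c2\<close>,
    \<open>c3\<close> then leaves \<open>c0\<close> at \<open>a\<close> and \<open>c1\<close> at
    \<open>b\<close>.\<close>
  then have xy: "y \<in> kcomp \<phi> c0 c1 x"
  proof cases
    case 1
    then show ?thesis by simp
  next
    case 2
    have "\<exists>\<psi>. proper_coloring E k \<psi> \<and> mis \<psi> c0 = {a, y} \<and> mis \<psi> c1 = {a, b, x, w} \<and>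
        mis \<psi> c2 = {b, w} \<and> mis \<psi> c3 = {x, w} \<and> kcomp \<psi> c2 c3 = kcomp \<phi> c2 c3"
      by (rule kempe_step[OF proper m0 m1 m2 m3 2(1)]) (use dist c in auto)
    then obtain \<psi> where \<psi>: "proper_coloring E k \<psi>" "mis \<psi> c0 = {a, y}"
      "mis \<psi> c1 = {a, b, x, w}" "mis \<psi> c2 = {b, w}" "mis \<psi> c3 = {x, w}"
      by blast
    have False by (rule no[of \<psi> c1 c2 c3 c0 c1]) (use \<psi> c in auto)
    then show ?thesis ..
  next
    case 3
    have "\<exists>\<psi>. proper_coloring E k \<psi> \<and> mis \<psi> c0 = {a, x} \<and> mis \<psi> c1 = {a, b, y, w} \<and>
        mis \<psi> c2 = {b, w} \<and> mis \<psi> c3 = {x, w} \<and> kcomp \<psi> c2 c3 = kcomp \<phi> c2 c3"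
      by (rule kempe_step[OF proper m0 m1 m2 m3 3(1)]) (use dist c in auto)
    then obtain \<psi> where \<psi>: "proper_coloring E k \<psi>" "mis \<psi> c0 = {a, x}"
      "mis \<psi> c1 = {a, b, y, w}" "mis \<psi> c2 = {b, w}" "mis \<psi> c3 = {x, w}"
      by blast
    have False by (rule no[of \<psi> c1 c2 c3 c0 c1]) (use \<psi> c in auto)
    then show ?thesis ..
  qed
  have "\<exists>\<psi>. proper_coloring E k \<psi> \<and> mis \<psi> c0 = {a, b} \<and> mis \<psi> c1 = {a, x, y, w} \<and>
      mis \<psi> c2 = {b, w} \<and> mis \<psi> c3 = {x, w} \<and> kcomp \<psi> c2 c3 = kcomp \<phi> c2 c3"
    by (rule kempe_step[OF proper m0 m1 m2 m3 xy]) (use dist c in auto)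
  then obtain \<phi>1 where \<phi>1: "proper_coloring E k \<phi>1" "mis \<phi>1 c0 = {a, b}"
     "mis \<phi>1 c1 = {a, x, y, w}" "mis \<phi>1 c2 = {b, w}" "mis \<phi>1 c3 = {x, w}"
    by blast
  have D2: "(mis \<phi>1 c0 - mis \<phi>1 c3) \<union> (mis \<phi>1 c3 - mis \<phi>1 c0) = {a, b, w, x}"
    using \<phi>1 dist by auto
  consider "b \<in> kcomp \<phi>1 c0 c3 a" "x \<in> kcomp \<phi>1 c0 c3 w"
    | "w \<in> kcomp \<phi>1 c0 c3 a" "x \<in> kcomp \<phi>1 c0 c3 b"
    | "x \<in> kcomp \<phi>1 c0 c3 a" "w \<in> kcomp \<phi>1 c0 c3 b"
    by (rule kempe_pairing[OF \<phi>1(1) cs(3) D2 ds(2)])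
  \<comment> \<open>If \<open>a\<close> were linked to \<open>b\<close> or \<open>x\<close>, an
    exchange would make \<open>a\<close> miss \<open>c3\<close>. Giving \<open>a w\<close>,
    \<open>b w\<close>, \<open>w x\<close> the colours \<open>c3\<close>, \<open>c2\<close>,
    \<open>c1\<close> then leaves \<open>c1\<close> at \<open>a\<close> and one of
    \<open>c3\<close>, \<open>c0\<close> at \<open>b\<close>.\<close>
  then have bx: "x \<in> kcomp \<phi>1 c0 c3 b"
  proof cases
    case 1
    have "\<exists>\<psi>. proper_coloring E k \<psi> \<and> mis \<psi> c0 = {} \<and> mis \<psi> c3 = {a, b, x, w} \<and>
        mis \<psi> c1 = {a, x, y, w} \<and> mis \<psi> c2 = {b, w} \<and> kcomp \<psi> c1 c2 = kcomp \<phi>1 c1 c2"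
      by (rule kempe_step[OF \<phi>1(1) \<phi>1(2) \<phi>1(5) \<phi>1(3) \<phi>1(4) 1(1)]) (use dist c in auto)
    then obtain \<psi> where \<psi>: "proper_coloring E k \<psi>" "mis \<psi> c0 = {}"
      "mis \<psi> c1 = {a, x, y, w}" "mis \<psi> c2 = {b, w}" "mis \<psi> c3 = {a, b, x, w}"
      by blast
    have False by (rule no[of \<psi> c3 c2 c1 c1 c3]) (use \<psi> c in auto)
    then show ?thesis ..
  next
    case 2
    then show ?thesis by simp
  next
    case 3
    have "\<exists>\<psi>. proper_coloring E k \<psi> \<and> mis \<psi> c0 = {b, x} \<and> mis \<psi> c3 = {a, w} \<and>
        mis \<psi> c1 = {a, x, y, w} \<and> mis \<psi> c2 = {b, w} \<and> kcomp \<psi> c1 c2 = kcomp \<phi>1 c1 c2"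
      by (rule kempe_step[OF \<phi>1(1) \<phi>1(2) \<phi>1(5) \<phi>1(3) \<phi>1(4) 3(1)]) (use dist c in auto)
    then obtain \<psi> where \<psi>: "proper_coloring E k \<psi>" "mis \<psi> c0 = {b, x}"
      "mis \<psi> c1 = {a, x, y, w}" "mis \<psi> c2 = {b, w}" "mis \<psi> c3 = {a, w}"
      by blast
    have False by (rule no[of \<psi> c3 c2 c1 c1 c0]) (use \<psi> c in auto)
    then show ?thesis ..
  qed
  have "\<exists>\<psi>. proper_coloring E k \<psi> \<and> mis \<psi> c0 = {a, x} \<and> mis \<psi> c3 = {b, w} \<and>
      mis \<psi> c1 = {a, x, y, w} \<and> mis \<psi> c2 = {b, w} \<and> kcomp \<psi> c1 c2 = kcomp \<phi>1 c1 c2"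
    by (rule kempe_step[OF \<phi>1(1) \<phi>1(2) \<phi>1(5) \<phi>1(3) \<phi>1(4) bx]) (use dist c in auto)
  then obtain \<phi>2 where \<phi>2: "proper_coloring E k \<phi>2" "mis \<phi>2 c0 = {a, x}"
     "mis \<phi>2 c1 = {a, x, y, w}" "mis \<phi>2 c2 = {b, w}" "mis \<phi>2 c3 = {b, w}"
    "kcomp \<phi>2 c1 c2 = kcomp \<phi>1 c1 c2"
    by blast
  \<comment> \<open>Since \<open>\<phi>1\<close> and \<open>\<phi>2\<close> differ by an exchange in
    \<open>c0\<close>, \<open>c3\<close>, their chains in \<open>c1\<close>, \<open>c2\<close>
    agree. Each pairing of \<open>a\<close>, \<open>b\<close>, \<open>x\<close>, \<open>y\<close>
    can thus be refuted in whichever of the two colourings suits it.\<close>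
  have D3: "(mis \<phi>1 c1 - mis \<phi>1 c2) \<union> (mis \<phi>1 c2 - mis \<phi>1 c1) = {a, b, x, y}"
    using \<phi>1 dist by auto
  consider "b \<in> kcomp \<phi>1 c1 c2 a" "y \<in> kcomp \<phi>1 c1 c2 x"
    | "x \<in> kcomp \<phi>1 c1 c2 a" "y \<in> kcomp \<phi>1 c1 c2 b"
    | "y \<in> kcomp \<phi>1 c1 c2 a" "x \<in> kcomp \<phi>1 c1 c2 b"
    by (rule kempe_pairing[OF \<phi>1(1) cs(4) D3 ds(3)])
  then show False
  proof cases
    case 1
    have "\<exists>\<psi>. proper_coloring E k \<psi> \<and> mis \<psi> c1 = {b, x, y, w} \<and> mis \<psi> c2 = {a, w} \<and>
        mis \<psi> c0 = {a, x} \<and> mis \<psi> c3 = {b, w} \<and> kcomp \<psi> c0 c3 = kcomp \<phi>2 c0 c3"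
      by (rule kempe_step[OF \<phi>2(1) \<phi>2(3) \<phi>2(4) \<phi>2(2) \<phi>2(5) 1(1)[folded \<phi>2(6)]]) (use dist c in auto)
    then obtain \<psi> where \<psi>: "proper_coloring E k \<psi>" "mis \<psi> c0 = {a, x}"
      "mis \<psi> c1 = {b, x, y, w}" "mis \<psi> c2 = {a, w}" "mis \<psi> c3 = {b, w}"
      by blast
    show False by (rule no[of \<psi> c2 c3 c1 c0 c1]) (use \<psi> c in auto)
  next
    case 2
    have "\<exists>\<psi>. proper_coloring E k \<psi> \<and> mis \<psi> c1 = {a, b, x, w} \<and> mis \<psi> c2 = {y, w} \<and>
        mis \<psi> c0 = {a, b} \<and> mis \<psi> c3 = {x, w} \<and> kcomp \<psi> c0 c3 = kcomp \<phi>1 c0 c3"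
      by (rule kempe_step[OF \<phi>1(1) \<phi>1(3) \<phi>1(4) \<phi>1(2) \<phi>1(5) 2(2)]) (use dist c in auto)
    then obtain \<phi>3 where \<phi>3: "proper_coloring E k \<phi>3" "mis \<phi>3 c0 = {a, b}"
      "mis \<phi>3 c1 = {a, b, x, w}" "mis \<phi>3 c2 = {y, w}" "mis \<phi>3 c3 = {x, w}"
      by blast
    \<comment> \<open>Whatever the other end of the chain at \<open>a\<close> is, exchanging it
      succeeds: \<open>w x\<close> takes \<open>c3\<close>, while \<open>a w\<close>,
      \<open>b w\<close> take \<open>c2\<close>, \<open>c1\<close>, or \<open>c1\<close>,
      \<open>c0\<close> if the chain ends at \<open>w\<close>.\<close>
    have D4: "(mis \<phi>3 c0 - mis \<phi>3 c2) \<union> (mis \<phi>3 c2 - mis \<phi>3 c0) = {a, b, w, y}"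
      using \<phi>3 dist by auto
    consider "b \<in> kcomp \<phi>3 c0 c2 a" "y \<in> kcomp \<phi>3 c0 c2 w"
      | "w \<in> kcomp \<phi>3 c0 c2 a" "y \<in> kcomp \<phi>3 c0 c2 b"
      | "y \<in> kcomp \<phi>3 c0 c2 a" "w \<in> kcomp \<phi>3 c0 c2 b"
      by (rule kempe_pairing[OF \<phi>3(1) cs(2) D4 ds(4)])
    then show False
    proof cases
      case 1
      have "\<exists>\<psi>. proper_coloring E k \<psi> \<and> mis \<psi> c0 = {} \<and> mis \<psi> c2 = {a, b, y, w} \<and>
          mis \<psi> c1 = {a, b, x, w} \<and> mis \<psi> c3 = {x, w} \<and> kcomp \<psi> c1 c3 = kcomp \<phi>3 c1 c3"
        by (rule kempe_step[OF \<phi>3(1) \<phi>3(2) \<phi>3(4) \<phi>3(3) \<phi>3(5) 1(1)]) (use dist c in auto)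
      then obtain \<psi> where \<psi>: "proper_coloring E k \<psi>" "mis \<psi> c0 = {}"
         "mis \<psi> c1 = {a, b, x, w}" "mis \<psi> c2 = {a, b, y, w}" "mis \<psi> c3 = {x, w}"
        by blast
      show False by (rule no[of \<psi> c2 c1 c3 c1 c2]) (use \<psi> c in auto)
    next
      case 2
      have "\<exists>\<psi>. proper_coloring E k \<psi> \<and> mis \<psi> c0 = {b, w} \<and> mis \<psi> c2 = {a, y} \<and>
          mis \<psi> c1 = {a, b, x, w} \<and> mis \<psi> c3 = {x, w} \<and> kcomp \<psi> c1 c3 = kcomp \<phi>3 c1 c3"
        by (rule kempe_step[OF \<phi>3(1) \<phi>3(2) \<phi>3(4) \<phi>3(3) \<phi>3(5) 2(1)]) (use dist c in auto)
      then obtain \<psi> where \<psi>: "proper_coloring E k \<psi>" "mis \<psi> c0 = {b, w}"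
         "mis \<psi> c1 = {a, b, x, w}" "mis \<psi> c2 = {a, y}" "mis \<psi> c3 = {x, w}"
        by blast
      show False by (rule no[of \<psi> c1 c0 c3 c2 c1]) (use \<psi> c in auto)
    next
      case 3
      have "\<exists>\<psi>. proper_coloring E k \<psi> \<and> mis \<psi> c0 = {b, y} \<and> mis \<psi> c2 = {a, w} \<and>
          mis \<psi> c1 = {a, b, x, w} \<and> mis \<psi> c3 = {x, w} \<and> kcomp \<psi> c1 c3 = kcomp \<phi>3 c1 c3"
        by (rule kempe_step[OF \<phi>3(1) \<phi>3(2) \<phi>3(4) \<phi>3(3) \<phi>3(5) 3(1)]) (use dist c in auto)
      then obtain \<psi> where \<psi>: "proper_coloring E k \<psi>" "mis \<psi> c0 = {b, y}"
         "mis \<psi> c1 = {a, b, x, w}" "mis \<psi> c2 = {a, w}" "mis \<psi> c3 = {x, w}"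
        by blast
      show False by (rule no[of \<psi> c2 c1 c3 c1 c0]) (use \<psi> c in auto)
    qed
  next
    case 3
    have "\<exists>\<psi>. proper_coloring E k \<psi> \<and> mis \<psi> c1 = {x, w} \<and> mis \<psi> c2 = {a, b, y, w} \<and>
        mis \<psi> c0 = {a, x} \<and> mis \<psi> c3 = {b, w} \<and> kcomp \<psi> c0 c3 = kcomp \<phi>2 c0 c3"
      by (rule kempe_step[OF \<phi>2(1) \<phi>2(3) \<phi>2(4) \<phi>2(2) \<phi>2(5) 3(1)[folded \<phi>2(6)]]) (use dist c in auto)
    then obtain \<psi> where \<psi>: "proper_coloring E k \<psi>" "mis \<psi> c0 = {a, x}"
      "mis \<psi> c1 = {x, w}" "mis \<psi> c2 = {a, b, y, w}" "mis \<psi> c3 = {b, w}"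
      by blast
    show False by (rule no[of \<psi> c2 c3 c1 c0 c2]) (use \<psi> c in auto)
  qed
qed

end

section \<open>Kierstead paths from the split edge\<close>

lemma missing_remove:
  assumes "proper_coloring E k \<phi>" "e \<in> E" "e \<subseteq> V"
  shows "missing V (E - {e}) \<phi> c = missing V E \<phi> c \<union> (if \<phi> e = c then e else {})"
  using assms proper_coloringD[OF assms(1)] unfolding missing_def by auto

lemma missing_insert:
  assumes "t \<in> missing V E \<phi> s" "t \<in> {u, w} \<Longrightarrow> s \<noteq> c"
  shows "t \<in> missing V (insert {u, w} E) (\<phi>({u, w} := c)) s"
  using assms unfolding missing_def by auto

lemma proper_coloring_insert_missing:
  assumes "proper_coloring E k \<phi>" "{u, w} \<notin> E" "c \<in> {1..k}"
    and "u \<in> missing V E \<phi> c" "w \<in> missing V E \<phi> c"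
  shows "proper_coloring (insert {u, w} E) k (\<phi>({u, w} := c))"
  using assms by (intro proper_coloring_insert) (auto simp: missing_def)

text \<open>No other edge at \<open>u\<close> carries the old colour of \<open>u w\<close>, so
  recolouring this edge frees that colour at \<open>u\<close>.\<close>

lemma proper_coloring_recolor:
  assumes "proper_coloring E k \<phi>" "{u, w} \<in> E" "c \<in> {1..k}"
    and "u \<in> missing V E \<phi> c" "w \<in> missing V E \<phi> c"
  shows "proper_coloring E k (\<phi>({u, w} := c))"
    and "u \<in> missing V E (\<phi>({u, w} := c)) (\<phi> {u, w})"
proof -
  have "proper_coloring (insert {u, w} (E - {{u, w}})) k (\<phi>({u, w} := c))"
    using assms by (intro proper_coloring_insert) (auto simp: missing_def intro: proper_coloring_subset)
  then show "proper_coloring E k (\<phi>({u, w} := c))" using assms(2) by (simp add: insert_absorb)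
  have "\<phi> {u, w} \<noteq> c" using assms(2,4) unfolding missing_def by blast
  moreover have "u \<in> V" using assms(4) unfolding missing_def by blast
  ultimately show "u \<in> missing V E (\<phi>({u, w} := c)) (\<phi> {u, w})"
    using proper_coloringD[OF assms(1) _ assms(2)] unfolding missing_def by auto
qed

lemma missing_recolor:
  assumes "t \<in> missing V E \<phi> s" "t \<notin> e"
  shows "t \<in> missing V E (\<phi>(e := c)) s"
  using assms unfolding missing_def by auto

text \<open>In the application \<open>E\<close> consists of the edges of \<open>G\<close> other than
  \<open>v1 v2\<close> and \<open>x y\<close>, and \<open>no_common\<close> says that
  \<open>v1 v2\<close> cannot be coloured. The setting is symmetric in the two sides, which
  \<open>flip\<close> exploits.\<close>

locale split_colorings = edge_set V E for V :: "'a set" and E +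
  fixes k :: nat and v1 v2 x y :: 'a and C1 C2 :: "nat set"
  assumes dist: "distinct [v1, v2, x, y]"
    and C_un: "C1 \<union> C2 = {1..k}" and C_disj: "C1 \<inter> C2 = {}"
    and no_common: "\<lbrakk>proper_coloring E k \<psi>; c \<in> {1..k}; v1 \<in> mis \<psi> c; v2 \<in> mis \<psi> c\<rbrakk> \<Longrightarrow> False"
begin

text \<open>\<open>C1\<close> and \<open>C2\<close> are the colours present at \<open>v1\<close> and at \<open>v2\<close>, so each colour is missing at
  exactly one of the two; in addition \<open>x\<close> and \<open>y\<close> miss the colour \<open>g\<close>.\<close>

definition state :: "('a set \<Rightarrow> nat) \<Rightarrow> nat \<Rightarrow> bool" where
  "state \<phi> g \<longleftrightarrow> proper_coloring E k \<phi> \<and> g \<in> {1..k} \<and>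
     (\<forall>c\<in>C1. mis \<phi> c = {v2} \<union> (if c = g then {x, y} else {})) \<and>
     (\<forall>c\<in>C2. mis \<phi> c = {v1} \<union> (if c = g then {x, y} else {}))"

lemma flip: "split_colorings V E k v2 v1 x y C2 C1"
  by unfold_locales (use dist C_un C_disj no_common in auto)

lemma state_flip: "split_colorings.state V E k v2 v1 x y C2 C1 \<phi> g \<longleftrightarrow> state \<phi> g"
  unfolding split_colorings.state_def[OF flip] state_def by auto

lemma state_x: "state \<phi> g \<Longrightarrow> x \<in> mis \<phi> g"
  using C_un unfolding state_def by (cases "g \<in> C1") auto

text \<open>The ends in the colours \<open>g\<close>, \<open>h\<close> are \<open>v1\<close>,
  \<open>v2\<close>, \<open>x\<close>, \<open>y\<close>. A chain from \<open>v1\<close> to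
  \<open>x\<close> or \<open>y\<close> could be exchanged to make \<open>v1\<close> miss
  \<open>g\<close> together with \<open>v2\<close>. So \<open>x\<close> and \<open>y\<close> are
  linked, and exchanging their chain moves their missing colour to \<open>h\<close> without touching
  the edges at \<open>v1\<close> and \<open>v2\<close>.\<close>

lemma shift:
  assumes st: "state \<phi> g" and g: "g \<in> C1" and h: "h \<in> C2"
  obtains \<psi> where "state \<psi> h"
    and "\<And>e. \<phi> e \<notin> {g, h} \<Longrightarrow> \<psi> e = \<phi> e"
    and "\<And>e. \<phi> e \<in> {g, h} \<Longrightarrow> \<psi> e \<in> {g, h}"
    and "\<And>e. e \<in> E \<Longrightarrow> v1 \<in> e \<or> v2 \<in> e \<Longrightarrow> \<psi> e = \<phi> e"
proof -
  have pr: "proper_coloring E k \<phi>" using st unfolding state_def by blast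
  have gh: "g \<noteq> h" "g \<in> {1..k}" "h \<in> {1..k}" using g h C_un C_disj by blast+
  have mg: "mis \<phi> g = {v2, x, y}" using st g unfolding state_def by auto
  have mh: "mis \<phi> h = {v1}" using st h gh unfolding state_def by auto
  have D: "(mis \<phi> g - mis \<phi> h) \<union> (mis \<phi> h - mis \<phi> g) = {v1, v2, x, y}"
    using mg mh dist by auto
  have bad: False if z: "z \<in> kcomp \<phi> g h v1" "z \<in> {x, y}" for z
  proof -
    have zD: "v1 \<in> {v1, v2, x, y}" "z \<in> {v1, v2, x, y}" "z \<noteq> v1" using z dist by auto
    show False
    proof (rule kempe_exchange[OF pr gh D zD z(1)])
      fix \<psi> assume "proper_coloring E k \<psi>"
        and "mis \<psi> g = (mis \<phi> g - {v1, z}) \<union> ({v1, z} - mis \<phi> g)"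
      moreover from this(2) have "v1 \<in> mis \<psi> g" "v2 \<in> mis \<psi> g" using mg z dist by auto
      ultimately show False using no_common gh by blast
    qed
  qed
  have xy: "y \<in> kcomp \<phi> g h x \<and> kcomp \<phi> g h v1 \<inter> kcomp \<phi> g h x = {} \<and> v2 \<in> kcomp \<phi> g h v1"
    using kempe_pairing[OF pr gh(1) D dist] bad by blast
  have xD: "x \<in> {v1, v2, x, y}" "y \<in> {v1, v2, x, y}" "y \<noteq> x" using dist by auto
  show thesis
  proof (rule kempe_exchange[OF pr gh D xD conjunct1[OF xy]])
    fix \<psi> assume \<psi>: "proper_coloring E k \<psi>"
        "mis \<psi> g = (mis \<phi> g - {x, y}) \<union> ({x, y} - mis \<phi> g)"
        "mis \<psi> h = (mis \<phi> h - {x, y}) \<union> ({x, y} - mis \<phi> h)"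
      and ot: "\<And>c. c \<notin> {g, h} \<Longrightarrow> mis \<psi> c = mis \<phi> c"
      and e1: "\<And>e. \<phi> e \<notin> {g, h} \<Longrightarrow> \<psi> e = \<phi> e"
      and e2: "\<And>e. e \<inter> kcomp \<phi> g h x = {} \<Longrightarrow> \<psi> e = \<phi> e"
      and e3: "\<And>e. \<phi> e \<in> {g, h} \<Longrightarrow> \<psi> e \<in> {g, h}"
    have mg': "mis \<psi> g = {v2}" and mh': "mis \<psi> h = {v1, x, y}"
      unfolding \<psi> mg mh using dist by auto
    have st': "state \<psi> h" unfolding state_def
    proof (intro conjI ballI)
      show "proper_coloring E k \<psi>" by fact
      show "h \<in> {1..k}" by fact
      fix c
      { assume "c \<in> C1"
        then show "mis \<psi> c = {v2} \<union> (if c = h then {x, y} else {})"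
          using st ot[of c] mg' h C_disj gh unfolding state_def by (cases "c = g") auto }
      { assume "c \<in> C2"
        then show "mis \<psi> c = {v1} \<union> (if c = h then {x, y} else {})"
          using st ot[of c] mh' g C_disj gh unfolding state_def by (cases "c = h") auto }
    qed
    have v12: "v1 \<notin> kcomp \<phi> g h x" "v2 \<notin> kcomp \<phi> g h x"
      using xy kempe_component_refl[of v1 E \<phi> g h] by blast+
    have fx: "\<psi> e = \<phi> e" if e: "e \<in> E" "v1 \<in> e \<or> v2 \<in> e" for e
    proof (cases "\<phi> e \<in> {g, h}")
      case True
      then have "e \<inter> kcomp \<phi> g h x = {}"
        using comp_closed[of e \<phi> g h x] e v12 by blast
      then show ?thesis by (rule e2)
    qed (rule e1)
    show thesis using that[OF st' e1 e3 fx] .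
  qed
qed

text \<open>If \<open>g\<close> is missing at both \<open>v1\<close> and \<open>x\<close>,
  recolouring \<open>v1 x\<close> with \<open>g\<close> frees its old colour at \<open>v1\<close>.
  That colour lies in \<open>C1\<close>, so \<open>v2\<close> misses it too. A shift brings the
  missing colour of \<open>x\<close> into \<open>C2\<close> first, if necessary.\<close>

lemma x_not_adjacent_v1:
  assumes st: "state \<phi> g" and e: "{v1, x} \<in> E" and C2: "C2 \<noteq> {}"
  shows False
proof -
  have *: False if st: "state \<phi> g" and g: "g \<in> C2" for \<phi> g
  proof -
    let ?b = "\<phi> {v1, x}"
    have pr: "proper_coloring E k \<phi>" using st unfolding state_def by blast
    have gk: "g \<in> {1..k}" using g C_un by blast
    have m: "v1 \<in> mis \<phi> g" "x \<in> mis \<phi> g" using st g unfolding state_def by auto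
    have bk: "?b \<in> {1..k}" using proper_coloring_range[OF pr e] .
    have "v1 \<notin> mis \<phi> ?b" using e unfolding missing_def by blast
    then have "?b \<in> C1" using st bk C_un unfolding state_def by auto
    then have "v2 \<in> mis \<phi> ?b" using st unfolding state_def by auto
    then have "v2 \<in> mis (\<phi>({v1, x} := g)) ?b" using dist by (intro missing_recolor) auto
    then show False
      using no_common[OF proper_coloring_recolor(1)[OF pr e gk m] bk]
        proper_coloring_recolor(2)[OF pr e gk m] by blast
  qed
  show False
  proof (cases "g \<in> C2")
    case True
    then show ?thesis using * st by blast
  next
    case False
    then have "g \<in> C1" using st C_un unfolding state_def by blast
    moreover obtain h where "h \<in> C2" using C2 by blast
    ultimately show ?thesis using shift[OF st] * by metis
  qed
qed

text \<open>The three vertices \<open>v1\<close>, \<open>w\<close>, \<open>x\<close> continue the uncoloured edge \<open>v2 v1\<close> to a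
  Kierstead path; the two spare colours at \<open>v1\<close> allow the missing colour of \<open>x\<close> to be moved to the
  colour of \<open>v1 w\<close> without disturbing the path.\<close>

lemma x_not_adjacent_w:
  assumes st: "state \<phi> g" and e: "{v1, w} \<in> E" and f: "{w, x} \<in> E"
    and w: "w \<notin> {v1, v2, x, y}" and C2: "h1 \<in> C2" "h2 \<in> C2" "h1 \<noteq> h2"
  shows False
proof -
  interpret fl: split_colorings V E k v2 v1 x y C2 C1 by (rule flip)
  have ef: "{v1, w} \<noteq> {w, x}" using w dist by (auto simp: doubleton_eq_iff)
  have C1I: "\<phi> {v1, w} \<in> C1" if "state \<phi> g" for \<phi> g
  proof -
    have pr: "proper_coloring E k \<phi>" using that unfolding state_def by blast
    have "v1 \<notin> mis \<phi> (\<phi> {v1, w})" using e unfolding missing_def by blast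
    then show ?thesis
      using that proper_coloring_range[OF pr e] C_un unfolding state_def by auto
  qed
  have gx: "\<phi> {w, x} \<noteq> g" if "state \<phi> g" for \<phi> g
    using state_x[OF that] f unfolding missing_def by blast
  have bd: "\<phi> {w, x} \<noteq> \<phi> {v1, w}" if "state \<phi> g" for \<phi> g
    using that e f ef proper_coloringD[of E k \<phi> "{v1, w}" "{w, x}" w] unfolding state_def by auto
  \<comment> \<open>Here \<open>x\<close> misses the colour of \<open>v1 w\<close> and
    \<open>v1\<close> misses the colour of \<open>w x\<close>. Interchanging the colours of these
    two edges frees the former at \<open>v1\<close>, where it is also missing at
    \<open>v2\<close>.\<close>
  have A: False if st: "state \<phi> (\<phi> {v1, w})" and d: "\<phi> {w, x} \<in> C2" for \<phi>
  proof -
    let ?b = "\<phi> {v1, w}" and ?d = "\<phi> {w, x}"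
    let ?F = "E - {{v1, w}} - {{w, x}}"
    have pr: "proper_coloring E k \<phi>" using st unfolding state_def by blast
    have k: "?b \<in> {1..k}" "?d \<in> {1..k}" using proper_coloring_range[OF pr] e f by auto
    have v1d: "v1 \<in> mis \<phi> ?d" using st d unfolding state_def by auto
    have xb: "x \<in> mis \<phi> ?b" using state_x[OF st] .
    have v2b: "v2 \<in> mis \<phi> ?b" using st C1I[OF st] unfolding state_def by auto
    let ?\<psi>1 = "\<phi>({v1, w} := ?d)" and ?\<psi> = "\<phi>({v1, w} := ?d, {w, x} := ?b)"
    have atw: "g = {v1, w}" if "g \<in> E" "w \<in> g" "\<phi> g = ?b" for g
      using proper_coloringD[OF pr that(1) e that(2)] that by auto
    have atw': "g = {w, x}" if "g \<in> E" "w \<in> g" "\<phi> g = ?d" for g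
      using proper_coloringD[OF pr that(1) f that(2)] that by auto
    have 1: "proper_coloring (insert {v1, w} ?F) k ?\<psi>1"
    proof (rule proper_coloring_insert)
      show "proper_coloring ?F k \<phi>" by (rule proper_coloring_subset[OF pr]) auto
      show "\<phi> g \<noteq> ?d" if "g \<in> ?F" "v1 \<in> g \<or> w \<in> g" for g
        using that atw'[of g] v1d unfolding missing_def by auto
    qed (use k in auto)
    have "proper_coloring (insert {w, x} (insert {v1, w} ?F)) k ?\<psi>"
    proof (rule proper_coloring_insert[OF 1])
      show "{w, x} \<notin> insert {v1, w} ?F" using ef by auto
      show "?\<psi>1 g \<noteq> ?b" if "g \<in> insert {v1, w} ?F" "w \<in> g \<or> x \<in> g" for g
        using that atw[of g] xb bd[OF st] unfolding missing_def by auto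
    qed (use k in auto)
    moreover have "insert {w, x} (insert {v1, w} ?F) = E" using e f by auto
    ultimately have pr': "proper_coloring E k ?\<psi>" by simp
    have "v2 \<in> mis ?\<psi> ?b" using v2b w dist by (intro missing_recolor) auto
    moreover have "v1 \<in> mis ?\<psi> ?b"
    proof -
      have "v1 \<in> V" using v1d unfolding missing_def by blast
      moreover have "?\<psi> g \<noteq> ?b" if "g \<in> E" "v1 \<in> g" for g
        using proper_coloringD[OF pr that(1) e that(2)] that w dist bd[OF st] by auto
      ultimately show ?thesis unfolding missing_def by blast
    qed
    ultimately show False using no_common[OF pr' k(1)] by blast
  qed
  \<comment> \<open>The shift with the sides exchanged moves the missing colour of \<open>x\<close>
    to that of \<open>v1 w\<close>; neither \<open>v1 w\<close> nor \<open>w x\<close> changes its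
    colour.\<close>
  have B': False if st: "state \<phi> g" and d: "\<phi> {w, x} \<in> C2" and g: "g \<in> C2" for \<phi> g
  proof -
    have "fl.state \<phi> g" using st state_flip by blast
    then obtain \<psi> where \<psi>: "fl.state \<psi> (\<phi> {v1, w})"
      and 1: "\<And>e. \<phi> e \<notin> {g, \<phi> {v1, w}} \<Longrightarrow> \<psi> e = \<phi> e"
      and 2: "\<And>e. e \<in> E \<Longrightarrow> v2 \<in> e \<or> v1 \<in> e \<Longrightarrow> \<psi> e = \<phi> e"
      using fl.shift[OF _ g C1I[OF st]] by metis
    have "\<psi> {v1, w} = \<phi> {v1, w}" using 2 e by blast
    moreover have "\<psi> {w, x} = \<phi> {w, x}" using 1 gx[OF st] bd[OF st] by blast
    ultimately show False using A[of \<psi>] \<psi> d state_flip by auto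
  qed
  have B: False if st: "state \<phi> g" and d: "\<phi> {w, x} \<in> C2" for \<phi> g
  proof (cases "g \<in> C2")
    case True
    then show ?thesis using B' st d by blast
  next
    case False
    then have g: "g \<in> C1" using st C_un unfolding state_def by blast
    \<comment> \<open>The second colour of \<open>C2\<close> is needed here: the shift must not
      involve the colour of \<open>w x\<close>.\<close>
    obtain h where h: "h \<in> C2" "h \<noteq> \<phi> {w, x}" using C2 by metis
    from shift[OF st g h(1)] obtain \<psi> where \<psi>: "state \<psi> h"
      and 1: "\<And>e. \<phi> e \<notin> {g, h} \<Longrightarrow> \<psi> e = \<phi> e" by metis
    have "\<psi> {w, x} = \<phi> {w, x}" using 1 gx[OF st] h by blast
    then show ?thesis using B'[OF \<psi>] d h by auto
  qed
  \<comment> \<open>If the colour of \<open>w x\<close> lies in \<open>C1\<close>, the missing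
    colour of \<open>x\<close> is shifted to it. Then \<open>w x\<close> can no longer have that
    colour and must have received \<open>g\<close>, which lies in \<open>C2\<close>.\<close>
  have C': False if st: "state \<phi> g" and g: "g \<in> C2" for \<phi> g
  proof (cases "\<phi> {w, x} \<in> C2")
    case True
    then show ?thesis using B st by blast
  next
    case False
    have pr: "proper_coloring E k \<phi>" using st unfolding state_def by blast
    then have d: "\<phi> {w, x} \<in> C1" using False proper_coloring_range[OF pr f] C_un by blast
    have "fl.state \<phi> g" using st state_flip by blast
    then obtain \<psi> where \<psi>: "fl.state \<psi> (\<phi> {w, x})"
      and 1: "\<And>e. \<phi> e \<in> {g, \<phi> {w, x}} \<Longrightarrow> \<psi> e \<in> {g, \<phi> {w, x}}"
      using fl.shift[OF _ g d] by metis
    have st': "state \<psi> (\<phi> {w, x})" using \<psi> state_flip by blast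
    have "\<psi> {w, x} = g" using 1[of "{w, x}"] gx[OF st'] by blast
    then show ?thesis using B[OF st'] g by blast
  qed
  show False
  proof (cases "g \<in> C2")
    case True
    then show ?thesis using C' st by blast
  next
    case False
    then have "g \<in> C1" using st C_un unfolding state_def by blast
    then show ?thesis using shift[OF st _ C2(1)] C' C2(1) by metis
  qed
qed

end

section \<open>Vertex splittings of regular Class 1 graphs\<close>

lemma card_neighbors:
  assumes "simple_graph R"
  shows "card (neighbors R u) = degree R u"
proof -
  have "bij_betw (\<lambda>t. {u, t}) (neighbors R u) {e \<in> edges R. u \<in> e}"
  proof (rule bij_betwI')
    fix e assume "e \<in> {e \<in> edges R. u \<in> e}"
    then have e: "e \<in> edges R" "u \<in> e" by auto
    then have "card e = 2" "e \<subseteq> verts R" using assms unfolding simple_graph_def by auto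
    then obtain t where "e = {u, t}" using e(2) by (auto simp: card_2_iff)
    then show "\<exists>t\<in>neighbors R u. e = {u, t}"
      using e \<open>e \<subseteq> verts R\<close> unfolding neighbors_def by auto
  qed (auto simp: neighbors_def doubleton_eq_iff)
  then show ?thesis unfolding degree_def by (rule bij_betw_same_card)
qed

text \<open>All edges may receive different colours; this ensures that the \<open>LEAST\<close> in
  \<open>chromatic_index\<close> is attained.\<close>

lemma proper_coloring_exists:
  assumes "simple_graph G"
  shows "\<exists>k \<phi>. proper_coloring (edges G) k \<phi>"
proof -
  have "edges G \<subseteq> Pow (verts G)" "finite (verts G)" using assms unfolding simple_graph_def by auto
  then have "finite (edges G)" using finite_subset by blast
  then obtain \<phi> :: "'a set \<Rightarrow> nat" where "bij_betw \<phi> (edges G) {1..card (edges G)}"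
    using ex_bij_betw_finite_nat finite_same_card_bij by (metis card_atLeastAtMost diff_Suc_1 finite_atLeastAtMost)
  then have "proper_coloring (edges G) (card (edges G)) \<phi>"
    unfolding proper_coloring_def bij_betw_def inj_on_def by blast
  then show ?thesis by blast
qed

text \<open>A fixed \<open>d\<close>-colouring \<open>\<phi>\<close> of \<open>R\<close> is part of
  the data. The pairs \<open>v1\<close>, \<open>N1\<close> and \<open>v2\<close>, \<open>N2\<close>
  enter symmetrically, so one-sided results transfer by \<open>flip\<close>.\<close>

locale splitting =
  fixes R G :: "'a ugraph" and v v1 v2 :: 'a and N1 N2 :: "'a set" and d :: nat
    and \<phi> :: "'a set \<Rightarrow> nat"
  assumes simple_R: "simple_graph R" and regular_R: "regular d R"
    and proper: "proper_coloring (edges R) d \<phi>"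
    and v: "v \<in> verts R" and v1: "v1 \<notin> verts R" and v2: "v2 \<notin> verts R" and v12: "v1 \<noteq> v2"
    and N_un: "N1 \<union> N2 = neighbors R v" and N_disj: "N1 \<inter> N2 = {}"
    and N1_ne: "N1 \<noteq> {}" and N2_ne: "N2 \<noteq> {}"
    and verts_G: "verts G = (verts R - {v}) \<union> {v1, v2}"
    and edges_G: "edges G = {e \<in> edges R. v \<notin> e} \<union> {{v1, v2}}
                    \<union> {{v1, u} | u. u \<in> N1} \<union> {{v2, u} | u. u \<in> N2}"
begin

lemma flip: "splitting R G v v2 v1 N2 N1 d \<phi>"
  by unfold_locales
    (use simple_R regular_R proper v v1 v2 v12 N_un N_disj N1_ne N2_ne verts_G edges_G
      in \<open>simp_all add: insert_commute Un_commute Int_commute Un_left_commute\<close>)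

lemma edge_R: "e \<in> edges R \<Longrightarrow> e \<subseteq> verts R" "e \<in> edges R \<Longrightarrow> card e = 2"
  using simple_R unfolding simple_graph_def by auto

lemma finite_R: "finite (verts R)"
  using simple_R unfolding simple_graph_def by blast

lemma N_facts: "u \<in> N1 \<union> N2 \<Longrightarrow> u \<in> verts R \<and> u \<noteq> v \<and> {v, u} \<in> edges R \<and> u \<noteq> v1 \<and> u \<noteq> v2"
proof -
  assume "u \<in> N1 \<union> N2"
  then have u: "u \<in> verts R" "{v, u} \<in> edges R" using N_un unfolding neighbors_def by auto
  then have "u \<noteq> v" using edge_R(2) by fastforce
  then show ?thesis using u v1 v2 by auto
qed

section \<open>Contracting the split edge back to the original vertex\<close>

definition core :: "'a set set" where
  "core = {e \<in> edges R. v \<notin> e} \<union> {{v1, u} | u. u \<in> N1} \<union> {{v2, u} | u. u \<in> N2}"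

text \<open>The contraction of \<open>v1 v2\<close> to \<open>v\<close>. On edges it is a bijection
  from \<open>core\<close>, the edges of \<open>G\<close> other than \<open>v1 v2\<close>, onto
  those of \<open>R\<close>, and colourings are pulled back along it.\<close>

definition merge :: "'a \<Rightarrow> 'a" where
  "merge t = (if t = v1 \<or> t = v2 then v else t)"

lemma edges_G_core: "edges G = insert {v1, v2} core"
  unfolding edges_G core_def by auto

lemma core_cases:
  assumes "e \<in> core"
  obtains (old) "e \<in> edges R" "v \<notin> e" "v1 \<notin> e" "v2 \<notin> e" "merge ` e = e"
  | (one) u where "u \<in> N1" "e = {v1, u}" "merge ` e = {v, u}"
  | (two) u where "u \<in> N2" "e = {v2, u}" "merge ` e = {v, u}"
proof -
  consider "e \<in> edges R" "v \<notin> e" | u where "u \<in> N1" "e = {v1, u}" | u where "u \<in> N2" "e = {v2, u}"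
    using assms unfolding core_def by auto
  then show thesis
  proof cases
    case 1
    then have "v1 \<notin> e" "v2 \<notin> e" using edge_R(1) v1 v2 by blast+
    moreover from this have "merge ` e = e" unfolding merge_def by (auto simp: image_def)
    ultimately show thesis using old 1 by blast
  next
    case (2 u)
    then show thesis using one[of u] N_facts[of u] unfolding merge_def by auto
  next
    case (3 u)
    then show thesis using two[of u] N_facts[of u] unfolding merge_def by auto
  qed
qed

lemma split_edge_notin_core: "{v1, v2} \<notin> core"
proof
  assume "{v1, v2} \<in> core"
  then show False
  proof (cases rule: core_cases)
    case (one u)
    then show False using N_facts[of u] v12 by (auto simp: doubleton_eq_iff)
  next
    case (two u)
    then show False using N_facts[of u] v12 by (auto simp: doubleton_eq_iff)
  qed blast
qed

lemma core_card_sub: "e \<in> core \<Longrightarrow> card e = 2 \<and> e \<subseteq> verts G"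
proof (erule core_cases)
  fix u assume "u \<in> N1" "e = {v1, u}"
  then show ?thesis using N_facts[of u] verts_G by auto
next
  fix u assume "u \<in> N2" "e = {v2, u}"
  then show ?thesis using N_facts[of u] verts_G by auto
qed (use edge_R verts_G in blast)

text \<open>An explicit inverse works: an edge \<open>v u\<close> goes back to \<open>v1 u\<close>
  or \<open>v2 u\<close> according to whether \<open>u\<close> lies in \<open>N1\<close>, and edges
  avoiding \<open>v\<close> stay.\<close>

lemma inj_merge: "inj_on (image merge) core"
proof (rule inj_on_inverseI)
  fix e assume "e \<in> core"
  then show "(if v \<notin> merge ` e then merge ` e
    else insert (if merge ` e - {v} \<subseteq> N1 then v1 else v2) (merge ` e - {v})) = e"
  proof (cases rule: core_cases)
    case (one u)
    then show ?thesis using N_facts[of u] by auto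
  next
    case (two u)
    then have "u \<notin> N1" using N_disj by blast
    then show ?thesis using two N_facts[of u] by auto
  qed simp
qed

lemma merge_core: "(image merge) ` core = edges R"
proof (intro equalityI subsetI)
  fix e assume "e \<in> (image merge) ` core"
  then obtain f where f: "f \<in> core" "e = merge ` f" by blast
  show "e \<in> edges R" by (rule core_cases[OF f(1)]) (use f(2) N_facts in auto)
next
  fix e assume e: "e \<in> edges R"
  show "e \<in> (image merge) ` core"
  proof (cases "v \<in> e")
    case False
    then have f: "e \<in> core" using e unfolding core_def by blast
    have "merge ` e = e" using edge_R(1)[OF e] v1 v2 unfolding merge_def by (auto simp: image_def)
    then show ?thesis using f by (metis imageI)
  next
    case True
    then obtain u where u: "e = {v, u}" "u \<noteq> v"
      using edge_R(2)[OF e] by (auto simp: card_2_iff)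
    then have "u \<in> N1 \<union> N2" using e edge_R(1) N_un unfolding neighbors_def by blast
    then consider "u \<in> N1" | "u \<in> N2" by blast
    then show ?thesis
    proof cases
      case 1
      then have "{v1, u} \<in> core" "merge ` {v1, u} = e"
        using u N_facts[of u] unfolding core_def merge_def by auto
      then show ?thesis by (metis imageI)
    next
      case 2
      then have "{v2, u} \<in> core" "merge ` {v2, u} = e"
        using u N_facts[of u] unfolding core_def merge_def by auto
      then show ?thesis by (metis imageI)
    qed
  qed
qed

lemma card_core: "card core = card (edges R)"
  using card_image[OF inj_merge] merge_core by simp

lemma proper_pullback:
  assumes "proper_coloring F k \<psi>" "D \<subseteq> core" "(image merge) ` D \<subseteq> F"
  shows "proper_coloring D k (\<lambda>e. \<psi> (merge ` e))"
  unfolding proper_coloring_def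
proof (intro conjI ballI impI)
  fix e assume "e \<in> D"
  then show "\<psi> (merge ` e) \<in> {1..k}" using assms proper_coloring_range by blast
next
  fix e f assume ef: "e \<in> D" "f \<in> D" "e \<noteq> f \<and> e \<inter> f \<noteq> {}"
  obtain t where t: "t \<in> e" "t \<in> f" using ef by blast
  have "e \<in> core" "f \<in> core" using ef assms(2) by auto
  then have ne: "merge ` e \<noteq> merge ` f" using ef inj_onD[OF inj_merge] by blast
  have "merge ` e \<in> F" "merge ` f \<in> F" using ef assms by auto
  then show "\<psi> (merge ` e) \<noteq> \<psi> (merge ` f)"
    using proper_coloringD[OF assms(1), of "merge ` e" "merge ` f" "merge t"] t ne by blast
qed

section \<open>The 1-factorization of \<open>R\<close> and its pullback\<close>

lemma card_neighbors_R: "u \<in> verts R \<Longrightarrow> card (neighbors R u) = d"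
  using card_neighbors[OF simple_R] regular_R unfolding regular_def by simp

text \<open>The \<open>d\<close> edges at \<open>u\<close> have different colours among
  \<open>d\<close> colours, so every colour occurs.\<close>

lemma color_at_vertex:
  assumes u: "u \<in> verts R" and c: "c \<in> {1..d}"
  shows "\<exists>e\<in>edges R. u \<in> e \<and> \<phi> e = c"
proof -
  let ?S = "{e \<in> edges R. u \<in> e}"
  have "inj_on \<phi> ?S" using proper unfolding inj_on_def by (auto dest: proper_coloringD)
  then have "card (\<phi> ` ?S) = d"
    using regular_R u by (simp add: card_image regular_def degree_def)
  moreover have "\<phi> ` ?S \<subseteq> {1..d}" using proper_coloring_range[OF proper] by blast
  ultimately have "\<phi> ` ?S = {1..d}" by (intro card_subset_eq) auto
  then show ?thesis using c by (metis (mono_tags, lifting) imageE mem_Collect_eq)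
qed

lemma missing_R:
  assumes "c \<in> {1..d}" shows "missing (verts R) (edges R) \<phi> c = {}"
proof -
  have "u \<notin> missing (verts R) (edges R) \<phi> c" if "u \<in> verts R" for u
    using color_at_vertex[OF that assms] unfolding missing_def by blast
  then show ?thesis unfolding missing_def by blast
qed

text \<open>The colours at \<open>v\<close> are divided between \<open>v1\<close> and
  \<open>v2\<close>. As each colour occurs exactly once at \<open>v\<close>, \<open>C1\<close> and
  \<open>C2\<close> partition \<open>{1..d}\<close>.\<close>

definition C1 :: "nat set" where "C1 = (\<lambda>u. \<phi> {v, u}) ` N1"
definition C2 :: "nat set" where "C2 = (\<lambda>u. \<phi> {v, u}) ` N2"

lemma inj_color_at_v: "inj_on (\<lambda>u. \<phi> {v, u}) (N1 \<union> N2)"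
proof (rule inj_onI)
  fix u t assume ut: "u \<in> N1 \<union> N2" "t \<in> N1 \<union> N2" "\<phi> {v, u} = \<phi> {v, t}"
  then have "{v, u} = {v, t}"
    using proper_coloringD[OF proper, of "{v, u}" "{v, t}" v] N_facts by blast
  then show "u = t" by (auto simp: doubleton_eq_iff)
qed

lemma C_disj: "C1 \<inter> C2 = {}"
  using inj_on_image_Int[OF inj_color_at_v, of N1 N2] N_disj unfolding C1_def C2_def by simp

lemma C_un: "C1 \<union> C2 = {1..d}"
proof (intro equalityI subsetI)
  fix c assume "c \<in> C1 \<union> C2"
  then show "c \<in> {1..d}"
    using proper_coloring_range[OF proper] N_facts unfolding C1_def C2_def by blast
next
  fix c assume "c \<in> {1..d}"
  then obtain e where e: "e \<in> edges R" "v \<in> e" "\<phi> e = c" using color_at_vertex v by blast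
  obtain u where u: "e = {v, u}" using edge_R(2)[OF e(1)] e(2) by (auto simp: card_2_iff)
  then have "u \<in> N1 \<union> N2" using e edge_R(1) N_un unfolding neighbors_def by blast
  then show "c \<in> C1 \<union> C2" using u e unfolding C1_def C2_def by blast
qed

definition \<psi> :: "'a set \<Rightarrow> nat" where "\<psi> e = \<phi> (merge ` e)"

lemma proper_core: "proper_coloring core d \<psi>"
  unfolding \<psi>_def[abs_def] by (rule proper_pullback[OF proper]) (simp_all add: merge_core)

text \<open>All colours are present at every vertex of \<open>R\<close>. The old vertices keep all
  of theirs, and each colour at \<open>v\<close> goes to exactly one of \<open>v1\<close>,
  \<open>v2\<close>.\<close>

lemma missing_core:
  assumes c: "c \<in> {1..d}"
  shows "missing (verts G) core \<psi> c = (if c \<in> C1 then {v2} else {v1})"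
proof -
  have v1m: "v1 \<in> missing (verts G) core \<psi> c \<longleftrightarrow> c \<notin> C1"
  proof
    assume m: "v1 \<in> missing (verts G) core \<psi> c"
    show "c \<notin> C1"
    proof
      assume "c \<in> C1"
      then obtain u where u: "u \<in> N1" "c = \<phi> {v, u}" unfolding C1_def by blast
      have "{v1, u} \<in> core" using u unfolding core_def by blast
      moreover have "\<psi> {v1, u} = c" using u N_facts[of u] unfolding \<psi>_def merge_def by (simp add: insert_commute)
      ultimately show False using m unfolding missing_def by blast
    qed
  next
    assume nc: "c \<notin> C1"
    have "\<psi> e \<noteq> c" if e: "e \<in> core" "v1 \<in> e" for e
      by (rule core_cases[OF e(1)]) (use e nc N_facts v12 in \<open>auto simp: \<psi>_def C1_def\<close>)
    then show "v1 \<in> missing (verts G) core \<psi> c" unfolding missing_def verts_G by blast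
  qed
  have v2m: "v2 \<in> missing (verts G) core \<psi> c \<longleftrightarrow> c \<notin> C2"
  proof
    assume m: "v2 \<in> missing (verts G) core \<psi> c"
    show "c \<notin> C2"
    proof
      assume "c \<in> C2"
      then obtain u where u: "u \<in> N2" "c = \<phi> {v, u}" unfolding C2_def by blast
      have "{v2, u} \<in> core" using u unfolding core_def by blast
      moreover have "\<psi> {v2, u} = c" using u N_facts[of u] unfolding \<psi>_def merge_def by (simp add: insert_commute)
      ultimately show False using m unfolding missing_def by blast
    qed
  next
    assume nc: "c \<notin> C2"
    have "\<psi> e \<noteq> c" if e: "e \<in> core" "v2 \<in> e" for e
      by (rule core_cases[OF e(1)]) (use e nc N_facts v12 in \<open>auto simp: \<psi>_def C2_def\<close>)
    then show "v2 \<in> missing (verts G) core \<psi> c" unfolding missing_def verts_G by blast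
  qed
  have "t \<notin> missing (verts G) core \<psi> c" if t: "t \<in> verts R" "t \<noteq> v" for t
  proof -
    obtain e where e: "e \<in> edges R" "t \<in> e" "\<phi> e = c" using color_at_vertex t c by blast
    then obtain f where f: "f \<in> core" "e = merge ` f" using merge_core by blast
    then have "t \<in> f" using e(2) t unfolding merge_def by (auto split: if_splits)
    moreover have "\<psi> f = c" using f e unfolding \<psi>_def by simp
    ultimately show ?thesis using f unfolding missing_def by blast
  qed
  then have "missing (verts G) core \<psi> c \<subseteq> {v1, v2}" unfolding missing_def verts_G by auto
  moreover have "c \<in> C1 \<longleftrightarrow> c \<notin> C2" using C_un C_disj c by blast
  ultimately show ?thesis using v1m v2m by auto
qed

lemma edge_set_core: "D \<subseteq> core \<Longrightarrow> edge_set (verts G) D"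
proof
  show "finite (verts G)" using verts_G finite_R by simp
qed (use core_card_sub in blast)+

lemma edge_set_R: "D \<subseteq> edges R \<Longrightarrow> edge_set (verts R) D"
proof
  show "finite (verts R)" by (rule finite_R)
qed (use edge_R in blast)+

lemma extend_core:
  assumes "proper_coloring (core - {e}) d \<chi>" "c \<in> {1..d}" "e \<noteq> {v1, v2}"
    and "v1 \<in> missing (verts G) (core - {e}) \<chi> c" "v2 \<in> missing (verts G) (core - {e}) \<chi> c"
  shows "\<exists>\<chi>. proper_coloring (edges G - {e}) d \<chi>"
proof -
  have "edges G - {e} = insert {v1, v2} (core - {e})" using edges_G_core assms(3) by blast
  moreover have "{v1, v2} \<notin> core - {e}" using split_edge_notin_core by blast
  ultimately show ?thesis
    using proper_coloring_insert_missing[OF assms(1) _ assms(2,4,5)] by metis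
qed

text \<open>Removing \<open>v1 u\<close> frees its colour at \<open>v1\<close>; \<open>v2\<close>
  misses that colour already, so \<open>v1 v2\<close> can take it.\<close>

lemma critical_at_v1:
  assumes u: "u \<in> N1"
  shows "\<exists>\<chi>. proper_coloring (edges G - {{v1, u}}) d \<chi>"
proof -
  let ?e = "{v1, u}" and ?c = "\<phi> {v, u}"
  have e: "?e \<in> core" using u unfolding core_def by blast
  have c: "?c \<in> {1..d}" "?c \<in> C1" using C_un u unfolding C1_def by auto
  have "\<psi> ?e = ?c" using N_facts[of u] u unfolding \<psi>_def merge_def by (simp add: insert_commute)
  then have m: "missing (verts G) (core - {?e}) \<psi> ?c = {v2} \<union> ?e"
    using missing_remove[OF proper_core e] core_card_sub[OF e] missing_core[OF c(1)] c(2) by auto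
  show ?thesis
  proof (rule extend_core[OF _ c(1)])
    show "proper_coloring (core - {?e}) d \<psi>" by (rule proper_coloring_subset[OF proper_core]) auto
    show "?e \<noteq> {v1, v2}" using split_edge_notin_core e by metis
  qed (use m in auto)
qed

end

text \<open>The sets \<open>A\<close> and \<open>B\<close> share at least
  \<open>card A + card B - card U\<close> elements, too many to be disjoint from \<open>C\<close>
  inside \<open>U\<close>.\<close>

lemma triple_Int_nonempty:
  assumes "finite U" "A \<subseteq> U" "B \<subseteq> U" "C \<subseteq> U" "card A + card B + card C > 2 * card U"
  shows "A \<inter> B \<inter> C \<noteq> {}"
proof
  assume "A \<inter> B \<inter> C = {}"
  have fin: "finite A" "finite B" "finite C" using assms finite_subset by blast+
  have "card A + card B = card (A \<union> B) + card (A \<inter> B)" by (rule card_Un_Int) fact+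
  moreover have "card (A \<inter> B) + card C = card (A \<inter> B \<union> C)"
    using \<open>A \<inter> B \<inter> C = {}\<close> fin by (intro card_Un_disjoint[symmetric]) auto
  moreover have "card (A \<union> B) \<le> card U" "card (A \<inter> B \<union> C) \<le> card U"
    using assms by (intro card_mono; blast)+
  ultimately show False using assms(5) by linarith
qed

lemma card_color_classes:
  assumes "proper_coloring E k \<phi>" "finite E"
  shows "card E = (\<Sum>c\<in>{1..k}. card {e \<in> E. \<phi> e = c})"
proof -
  have "E = (\<Union>c\<in>{1..k}. {e \<in> E. \<phi> e = c})"
    using proper_coloring_range[OF assms(1)] by blast
  then have "card E = card (\<Union>c\<in>{1..k}. {e \<in> E. \<phi> e = c})" by simp
  also have "\<dots> = (\<Sum>c\<in>{1..k}. card {e \<in> E. \<phi> e = c})"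
    using assms(2) by (intro card_UN_disjoint) auto
  finally show ?thesis .
qed

context splitting
begin

section \<open>Old edges when both new vertices have degree at least 3\<close>

lemma neighbors_sym: "u \<in> verts R \<Longrightarrow> t \<in> neighbors R u \<Longrightarrow> u \<in> neighbors R t"
  unfolding neighbors_def by (simp add: insert_commute)

lemma neighbors_neq: "t \<in> neighbors R u \<Longrightarrow> t \<noteq> u"
  using edge_R(2) unfolding neighbors_def by fastforce

lemma finite_neighbors: "finite (neighbors R u)"
  using finite_R unfolding neighbors_def by simp

lemma finite_N: "finite N1" "finite N2"
  using N_un finite_neighbors finite_Un by metis+

lemma card_N: "card N1 + card N2 = d"
  using card_Un_disjoint[OF finite_N N_disj] N_un card_neighbors_R[OF v] by simp

lemma old_edge_in_core: "e \<in> edges R \<Longrightarrow> v \<notin> e \<Longrightarrow> e \<in> core"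
  unfolding core_def by blast

text \<open>A colour missing at both \<open>v1\<close> and \<open>v2\<close> could be given to
  \<open>v1 v2\<close>, which yields \<open>no_common\<close>. Deleting \<open>x y\<close> adds its
  ends to the missing set of its own colour, which yields \<open>state\<close>.\<close>

lemma split_colorings_core:
  assumes e: "{x, y} \<in> edges R" "v \<notin> {x, y}"
    and no: "\<not> (\<exists>\<chi>. proper_coloring (edges G - {{x, y}}) d \<chi>)"
  shows "split_colorings (verts G) (core - {{x, y}}) d v1 v2 x y C1 C2" (is ?A)
    and "split_colorings.state (verts G) (core - {{x, y}}) d v1 v2 x y C1 C2 \<psi> (\<psi> {x, y})"
proof -
  let ?E = "core - {{x, y}}"
  interpret edge_set "verts G" ?E by (rule edge_set_core) blast
  have xy: "x \<in> verts R" "y \<in> verts R" "x \<noteq> y" using edge_R[OF e(1)] by auto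
  then have ne: "{x, y} \<noteq> {v1, v2}" using v1 by (auto simp: doubleton_eq_iff)
  show A: ?A
  proof
    show "distinct [v1, v2, x, y]" using xy v1 v2 v12 by auto
    show "C1 \<union> C2 = {1..d}" by (rule C_un)
    show "C1 \<inter> C2 = {}" by (rule C_disj)
    show False if "proper_coloring ?E d \<chi>" "c \<in> {1..d}" "v1 \<in> mis \<chi> c" "v2 \<in> mis \<chi> c" for \<chi> c
      using extend_core[OF that(1,2) ne that(3,4)] no by blast
  qed
  have ec: "{x, y} \<in> core" using old_edge_in_core e by blast
  have eV: "{x, y} \<subseteq> verts G" using core_card_sub[OF ec] by blast
  have m: "mis \<psi> c = (if c \<in> C1 then {v2} else {v1}) \<union> (if c = \<psi> {x, y} then {x, y} else {})"
    if "c \<in> {1..d}" for c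
    using missing_remove[OF proper_core ec eV, of c] missing_core[OF that] by auto
  show "split_colorings.state (verts G) ?E d v1 v2 x y C1 C2 \<psi> (\<psi> {x, y})"
    unfolding split_colorings.state_def[OF A]
  proof (intro conjI ballI)
    show "proper_coloring ?E d \<psi>" by (rule proper_coloring_subset[OF proper_core]) blast
    show "\<psi> {x, y} \<in> {1..d}" using proper_coloring_range[OF proper_core ec] .
    fix c
    { assume "c \<in> C1"
      moreover from this have "c \<in> {1..d}" using C_un by blast
      ultimately show "mis \<psi> c = {v2} \<union> (if c = \<psi> {x, y} then {x, y} else {})"
        using m[of c] by simp }
    { assume "c \<in> C2"
      then have "c \<notin> C1" "c \<in> {1..d}" using C_disj C_un by blast+
      then show "mis \<psi> c = {v1} \<union> (if c = \<psi> {x, y} then {x, y} else {})"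
        using m[of c] by simp }
  qed
qed

lemma C_nonempty: "C1 \<noteq> {}" "C2 \<noteq> {}"
  unfolding C1_def C2_def using N1_ne N2_ne by auto

lemma not_neighbor_v:
  assumes e: "{x, y} \<in> edges R" "v \<notin> {x, y}"
    and no: "\<not> (\<exists>\<chi>. proper_coloring (edges G - {{x, y}}) d \<chi>)"
  shows "x \<notin> neighbors R v"
proof
  assume "x \<in> neighbors R v"
  then consider "x \<in> N1" | "x \<in> N2" using N_un by blast
  then show False
  proof cases
    case 1
    have "{v1, x} \<in> core" using 1 unfolding core_def by blast
    moreover have "{v1, x} \<noteq> {x, y}" using edge_R(1)[OF e(1)] v1 by blast
    ultimately show False
      using split_colorings.x_not_adjacent_v1[OF split_colorings_core[OF assms]] C_nonempty by blast
  next
    case 2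
    have "{v2, x} \<in> core" using 2 unfolding core_def by blast
    moreover have "{v2, x} \<noteq> {x, y}" using edge_R(1)[OF e(1)] v2 by blast
    ultimately show False
      using split_colorings.x_not_adjacent_v1[OF split_colorings.flip[OF split_colorings_core(1)[OF assms]]
          split_colorings.state_flip[OF split_colorings_core(1)[OF assms], THEN iffD2,
            OF split_colorings_core(2)[OF assms]]] C_nonempty by blast
  qed
qed

lemma two_colors:
  assumes "card N1 \<ge> 2"
  shows "\<exists>h1\<in>C1. \<exists>h2\<in>C1. h1 \<noteq> h2"
proof (rule ccontr)
  assume "\<not> ?thesis"
  moreover have "finite C1" using finite_N unfolding C1_def by simp
  ultimately have "card C1 \<le> Suc 0" using card_le_Suc0_iff_eq[of C1] by blast
  moreover have "card C1 = card N1"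
    unfolding C1_def by (rule card_image) (rule inj_on_subset[OF inj_color_at_v], blast)
  ultimately show False using assms by simp
qed

text \<open>The neighbours of \<open>x\<close> avoid \<open>v\<close>, \<open>x\<close> and the
  neighbours of \<open>v\<close>, a set of size \<open>d + 2\<close>. So \<open>R\<close> has at
  least \<open>2 * d + 2\<close> vertices, against the density bound.\<close>

lemma critical_large:
  assumes e: "{x, y} \<in> edges R" "v \<notin> {x, y}"
    and N: "card N1 \<ge> 2" "card N2 \<ge> 2" and dense: "2 * card (verts R) \<le> 3 * d + 2"
  shows "\<exists>\<chi>. proper_coloring (edges G - {{x, y}}) d \<chi>"
proof (rule ccontr)
  assume no: "\<not> ?thesis"
  let ?E = "core - {{x, y}}"
  interpret sc: split_colorings "verts G" ?E d v1 v2 x y C1 C2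
    by (rule split_colorings_core[OF e no])
  interpret fl: split_colorings "verts G" ?E d v2 v1 x y C2 C1 by (rule sc.flip)
  have st: "sc.state \<psi> (\<psi> {x, y})" by (rule split_colorings_core[OF e no])
  then have st': "fl.state \<psi> (\<psi> {x, y})" using sc.state_flip by blast
  have xv: "x \<notin> neighbors R v" using not_neighbor_v[OF e no] .
  \<comment> \<open>This excludes \<open>w = y\<close> below, in which case \<open>w x\<close> would
    be the deleted edge.\<close>
  have yv: "y \<notin> neighbors R v" using not_neighbor_v[of y x] e no by (simp add: insert_commute)
  have xy: "x \<in> verts R" "x \<noteq> v" using edge_R(1)[OF e(1)] e(2) by auto
  \<comment> \<open>The colours present at one of \<open>v1\<close>, \<open>v2\<close> are the spare
    colours at the other, and the Kierstead path argument uses two of them.\<close>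
  obtain h1 h2 where h: "h1 \<in> C1" "h2 \<in> C1" "h1 \<noteq> h2" using two_colors N by blast
  obtain g1 g2 where g: "g1 \<in> C2" "g2 \<in> C2" "g1 \<noteq> g2"
    using splitting.two_colors[OF flip N(2)] unfolding splitting.C1_def[OF flip] C2_def by blast
  have "w \<notin> neighbors R v" "w \<noteq> v" if w: "w \<in> neighbors R x" for w
  proof -
    have wR: "w \<in> verts R" "{w, x} \<in> edges R" "w \<noteq> x"
      using w neighbors_neq unfolding neighbors_def by (auto simp: insert_commute)
    show "w \<noteq> v" using w xv neighbors_sym[OF xy(1), of v] by blast
    then have "{w, x} \<in> core" using old_edge_in_core wR xy by blast
    show "w \<notin> neighbors R v"
    proof
      assume wv: "w \<in> neighbors R v"
      then have "w \<noteq> y" using yv by blast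
      then have 1: "{w, x} \<in> ?E" using \<open>{w, x} \<in> core\<close> wR by (auto simp: doubleton_eq_iff)
      have 2: "w \<notin> {v1, v2, x, y}" using wR v1 v2 \<open>w \<noteq> y\<close> by auto
      consider "w \<in> N1" | "w \<in> N2" using wv N_un by blast
      then show False
      proof cases
        case 1
        have "{v1, w} \<in> ?E" using 1 edge_R(1)[OF e(1)] v1 unfolding core_def by blast
        then show False using sc.x_not_adjacent_w[OF st _ \<open>{w, x} \<in> ?E\<close> 2 g] by blast
      next
        case 2
        have "{v2, w} \<in> ?E" using 2 edge_R(1)[OF e(1)] v2 unfolding core_def by blast
        moreover have "w \<notin> {v2, v1, x, y}" using \<open>w \<notin> {v1, v2, x, y}\<close> by blast
        ultimately show False using fl.x_not_adjacent_w[OF st' _ \<open>{w, x} \<in> ?E\<close> _ h] by blast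
      qed
    qed
  qed
  then have "neighbors R x \<subseteq> verts R - insert v (insert x (neighbors R v))"
    using neighbors_neq unfolding neighbors_def by blast
  then have "card (neighbors R x) \<le> card (verts R - insert v (insert x (neighbors R v)))"
    using finite_R by (intro card_mono) auto
  also have "\<dots> = card (verts R) - card (insert v (insert x (neighbors R v)))"
    using v xy finite_neighbors by (intro card_Diff_subset) (auto simp: neighbors_def)
  also have "card (insert v (insert x (neighbors R v))) = d + 2"
  proof -
    have "v \<notin> neighbors R v" using neighbors_neq by blast
    then show ?thesis using xv xy(2) finite_neighbors[of v] card_neighbors_R[OF v] by simp
  qed
  finally have "d \<le> card (verts R) - (d + 2)" using card_neighbors_R xy by simp
  \<comment> \<open>As the subtraction is truncated, \<open>d > 0\<close> is what rules out that
    \<open>card (verts R)\<close> is below \<open>d + 2\<close>.\<close>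
  moreover have "d > 0" using card_N N by simp
  ultimately show False using dense by linarith
qed

section \<open>Too many edges for \<open>d\<close> matchings, and the maximum degree of
  \<open>G\<close>\<close>

lemma no_coloring_G: "\<not> proper_coloring (edges G) d \<chi>"
proof
  assume pr: "proper_coloring (edges G) d \<chi>"
  interpret r: edge_set "verts R" "edges R" by (rule edge_set_R) simp
  interpret g: edge_set "verts G" "edges G"
  proof
    show "finite (verts G)" using verts_G finite_R by simp
    show "e \<subseteq> verts G" "card e = 2" if "e \<in> edges G" for e
      using that core_card_sub[of e] v12 verts_G unfolding edges_G_core by auto
  qed
  \<comment> \<open>No colour is missing anywhere in \<open>R\<close>, so each colour class is a
    perfect matching and the number of vertices is even.\<close>
  have R: "card (verts R) = 2 * card {e \<in> edges R. \<phi> e = c}" if "c \<in> {1..d}" for c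
  proof -
    have "{e \<in> edges R. \<phi> e = c \<and> e \<subseteq> verts R} = {e \<in> edges R. \<phi> e = c}" using edge_R by blast
    then show ?thesis
      using r.card_covered[OF proper subset_refl, of c] edge_R(1) missing_R[OF that] by simp
  qed
  have "1 \<in> {1..d}" using card_N N1_ne finite_N(1) by (auto simp: Suc_le_eq card_gt_0_iff)
  then have ev: "even (card (verts R))" using R by (metis dvd_triv_left)
  have "card (verts G) = card (verts R - {v}) + 2"
    unfolding verts_G using finite_R v1 v2 v12 by (subst card_Un_disjoint) auto
  then have cG: "card (verts G) = card (verts R) + 1"
    using finite_R v by (simp add: card_Diff_singleton card_gt_0_iff)
      (metis One_nat_def Suc_pred card_gt_0_iff empty_iff finite_R)
  \<comment> \<open>The number of vertices of \<open>G\<close> is odd, so a matching misses a vertex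
    and is no larger than a colour class of \<open>R\<close>.\<close>
  have G: "2 * card {e \<in> edges G. \<chi> e = c} \<le> card (verts R)" for c
  proof -
    have "{e \<in> edges G. \<chi> e = c \<and> e \<subseteq> verts G} = {e \<in> edges G. \<chi> e = c}"
      using g.edge_sub by blast
    then have "2 * card {e \<in> edges G. \<chi> e = c} \<le> card (verts R) + 1"
      using g.card_covered[OF pr subset_refl, of c] g.edge_sub cG by simp
    moreover have "2 * m \<le> n" if "2 * m \<le> n + 1" "even n" for m n :: nat
      using that by presburger
    ultimately show ?thesis using ev by blast
  qed
  have "2 * card (edges G) = (\<Sum>c\<in>{1..d}. 2 * card {e \<in> edges G. \<chi> e = c})"
    unfolding card_color_classes[OF pr g.finite_E] by (rule sum_distrib_left)
  also have "\<dots> \<le> (\<Sum>c\<in>{1..d}. 2 * card {e \<in> edges R. \<phi> e = c})"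
  proof (rule sum_mono)
    fix c assume "c \<in> {1..d}"
    then show "2 * card {e \<in> edges G. \<chi> e = c} \<le> 2 * card {e \<in> edges R. \<phi> e = c}"
      using G[of c] R[of c] by simp
  qed
  also have "\<dots> = 2 * card (edges R)"
    unfolding card_color_classes[OF proper r.finite_E] by (rule sum_distrib_left[symmetric])
  finally have "card (edges G) \<le> card core" using card_core by simp
  moreover have "finite core" using g.finite_E edges_G_core by simp
  ultimately show False using split_edge_notin_core edges_G_core by simp
qed

text \<open>Since \<open>N2\<close> is nonempty, at least one edge of \<open>v\<close> went to
  \<open>v2\<close>, which makes room for \<open>v1 v2\<close>.\<close>

lemma degree_v1_le: "degree G v1 \<le> d"
proof -
  have "{e \<in> edges G. v1 \<in> e} \<subseteq> insert {v1, v2} ((\<lambda>u. {v1, u}) ` N1)"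
  proof
    fix e assume "e \<in> {e \<in> edges G. v1 \<in> e}"
    then have "e = {v1, v2} \<or> e \<in> core" "v1 \<in> e" unfolding edges_G_core by auto
    then show "e \<in> insert {v1, v2} ((\<lambda>u. {v1, u}) ` N1)"
    proof (elim disjE)
      assume "e \<in> core" "v1 \<in> e"
      then show ?thesis
      proof (cases rule: core_cases)
        case (two u)
        then show ?thesis using \<open>v1 \<in> e\<close> v12 N_facts[of u] by auto
      qed auto
    qed simp
  qed
  then have "degree G v1 \<le> card (insert {v1, v2} ((\<lambda>u. {v1, u}) ` N1))"
    unfolding degree_def using finite_N by (intro card_mono) auto
  also have "\<dots> \<le> Suc (card ((\<lambda>u. {v1, u}) ` N1))" by (rule card_insert_le_m1) auto
  also have "\<dots> \<le> Suc (card N1)" using card_image_le finite_N by blast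
  also have "\<dots> \<le> d" using card_N N2_ne finite_N(2) by (metis Suc_leI add_Suc_right add.commute card_gt_0_iff le_add1 less_add_same_cancel1)
  finally show ?thesis .
qed

lemma degree_old:
  assumes u: "u \<in> verts R" "u \<noteq> v"
  shows "degree G u = d"
proof -
  have u12: "u \<noteq> v1" "u \<noteq> v2" using u v1 v2 by auto
  have "{e \<in> edges G. u \<in> e} = {e \<in> core. u \<in> e}" unfolding edges_G_core using u12 by auto
  moreover have "(image merge) ` {e \<in> core. u \<in> e} = {e \<in> edges R. u \<in> e}"
  proof -
    have "u \<in> merge ` e \<longleftrightarrow> u \<in> e" for e
      using u u12 unfolding merge_def by (auto simp: image_iff)
    then have "(image merge) ` {e \<in> core. u \<in> e} = {e \<in> (image merge) ` core. u \<in> e}" by blast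
    then show ?thesis using merge_core by simp
  qed
  moreover have "inj_on (image merge) {e \<in> core. u \<in> e}"
    by (rule inj_on_subset[OF inj_merge]) auto
  ultimately have "degree G u = degree R u"
    unfolding degree_def using card_image[of "image merge" "{e \<in> core. u \<in> e}"] by simp
  then show ?thesis using regular_R u unfolding regular_def by simp
qed

lemma max_degree_G: "max_degree G = d"
proof -
  obtain u where "u \<in> N1" using N1_ne by blast
  then have "u \<in> verts R" "u \<noteq> v" using N_facts by auto
  then have "d \<in> degree G ` verts G" using degree_old verts_G by (metis DiffI UnI1 imageI singletonD)
  moreover have "degree G t \<le> d" if "t \<in> verts G" for t
    using that degree_old degree_v1_le splitting.degree_v1_le[OF flip] unfolding verts_G by fastforce
  moreover have "finite (verts G)" using verts_G finite_R by simp
  ultimately show ?thesis unfolding max_degree_def by (intro Max_eqI) auto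
qed

section \<open>Old edges when \<open>v2\<close> has degree 2\<close>

lemma extend_subdivision:
  fixes b
  defines "E x y \<equiv> edges R - {{v, b}} - {{x, y}}"
  assumes N2: "N2 = {b}" and e: "{x, y} \<in> edges R" "v \<notin> {x, y}"
    and pr: "proper_coloring (E x y) d \<chi>" and st: "s \<in> {1..d}" "t \<in> {1..d}" "s \<noteq> t"
    and m: "v \<in> missing (verts R) (E x y) \<chi> s" "b \<in> missing (verts R) (E x y) \<chi> t"
  shows "\<exists>\<chi>. proper_coloring (edges G - {{x, y}}) d \<chi>"
proof -
  let ?e = "{x, y}" and ?f = "{v2, b}"
  let ?D = "core - {?e} - {?f}"
  let ?\<chi> = "\<lambda>g. \<chi> (merge ` g)"
  have bN: "b \<in> verts R" "b \<noteq> v" "b \<noteq> v1" "b \<noteq> v2" using N_facts[of b] N2 by auto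
  have eR: "v1 \<notin> ?e" "v2 \<notin> ?e" using edge_R(1)[OF e(1)] v1 v2 by blast+
  have me: "merge ` ?e = ?e" using eR unfolding merge_def by auto
  have mf: "merge ` ?f = {v, b}" using bN unfolding merge_def by auto
  have ec: "?e \<in> core" using old_edge_in_core e by blast
  have fc: "?f \<in> core" using N2 unfolding core_def by blast
  have sub: "(image merge) ` ?D \<subseteq> E x y"
  proof
    fix h assume "h \<in> (image merge) ` ?D"
    then obtain g where g: "g \<in> core" "g \<noteq> ?e" "g \<noteq> ?f" "h = merge ` g" by blast
    have "h \<in> edges R" using g merge_core by blast
    moreover have "h \<noteq> ?e" using inj_onD[OF inj_merge _ g(1) ec] g(2,4) me by metis
    moreover have "h \<noteq> {v, b}" using inj_onD[OF inj_merge _ g(1) fc] g(3,4) mf by metis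
    ultimately show "h \<in> E x y" unfolding E_def by blast
  qed
  have D: "proper_coloring ?D d ?\<chi>" by (rule proper_pullback[OF pr _ sub]) blast
  \<comment> \<open>The only edges of \<open>G\<close> at \<open>v2\<close> are \<open>v1 v2\<close>
    and \<open>v2 b\<close>, and neither belongs to \<open>?D\<close>.\<close>
  have v2D: "v2 \<notin> g" if "g \<in> ?D" for g
  proof
    assume "v2 \<in> g"
    from that have "g \<in> core" by blast
    then show False
    proof (cases rule: core_cases)
      case (one u)
      then show False using \<open>v2 \<in> g\<close> v12 N_facts[of u] by auto
    next
      case (two u)
      then show False using that N2 by auto
    qed (use \<open>v2 \<in> g\<close> in blast)
  qed
  have bD: "?\<chi> g \<noteq> t" if "g \<in> ?D" "b \<in> g" for g
  proof -
    have "b \<in> merge ` g" using that(2) bN unfolding merge_def by (auto simp: image_iff)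
    then show ?thesis using m(2) that(1) sub unfolding missing_def by blast
  qed
  have v1D: "?\<chi> g \<noteq> s" if "g \<in> ?D" "v1 \<in> g" for g
  proof -
    have "v \<in> merge ` g" using that(2) unfolding merge_def by (auto simp: image_iff)
    then show ?thesis using m(1) that(1) sub unfolding missing_def by blast
  qed
  \<comment> \<open>Once \<open>v2 b\<close> has colour \<open>t\<close>, the different colour
    \<open>s\<close> is free at both \<open>v1\<close> and \<open>v2\<close>.\<close>
  let ?\<chi>' = "?\<chi>(?f := t)"
  have "proper_coloring (insert ?f ?D) d ?\<chi>'"
    by (rule proper_coloring_insert[OF D]) (use v2D bD st in blast)+
  moreover have ins: "insert ?f ?D = core - {?e}" using fc eR by blast
  ultimately have pr': "proper_coloring (core - {?e}) d ?\<chi>'" by simp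
  have V: "v1 \<in> verts G" "v2 \<in> verts G" using verts_G by auto
  have "?\<chi>' g \<noteq> s" if "g \<in> insert ?f ?D" "v1 \<in> g \<or> v2 \<in> g" for g
  proof (cases "g = ?f")
    case True
    then show ?thesis using st(3) by simp
  next
    case False
    then have "g \<in> ?D" using that(1) by blast
    then show ?thesis using False v1D v2D that(2) by auto
  qed
  then have "v1 \<in> missing (verts G) (core - {?e}) ?\<chi>' s" "v2 \<in> missing (verts G) (core - {?e}) ?\<chi>' s"
    using V unfolding missing_def ins by blast+
  moreover have "?e \<noteq> {v1, v2}" using eR by blast
  ultimately show ?thesis using extend_core[OF pr' st(1)] by blast
qed

lemma critical_subdivision:
  assumes N2: "N2 = {b}" and e: "{x, y} \<in> edges R" "v \<notin> {x, y}"
    and dense: "2 * card (verts R) \<le> 3 * d + 2"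
  shows "\<exists>\<chi>. proper_coloring (edges G - {{x, y}}) d \<chi>"
proof (rule ccontr)
  assume no: "\<not> ?thesis"
  let ?e = "{x, y}" and ?f = "{v, b}"
  define E where "E = edges R - {?f} - {?e}"
  interpret E: edge_set "verts R" E by (rule edge_set_R) (auto simp: E_def)
  have NC: False if "proper_coloring E d \<chi>" "s \<in> {1..d}" "t \<in> {1..d}" "s \<noteq> t"
    "v \<in> E.mis \<chi> s" "b \<in> E.mis \<chi> t" for \<chi> s t
    using extend_subdivision[OF N2 e] that no unfolding E_def by blast
  have b: "b \<in> verts R" "b \<noteq> v" "?f \<in> edges R" using N_facts[of b] N2 by auto
  have xy: "x \<in> verts R" "y \<in> verts R" "x \<noteq> y" using edge_R[OF e(1)] by auto
  have fe: "?f \<noteq> ?e" using e(2) by blast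
  let ?\<alpha> = "\<phi> ?f" and ?\<gamma> = "\<phi> ?e"
  have prE: "proper_coloring E d \<phi>" by (rule proper_coloring_subset[OF proper]) (auto simp: E_def)
  have ag: "?\<alpha> \<in> {1..d}" "?\<gamma> \<in> {1..d}" using proper_coloring_range[OF proper] b e by auto
  have m0: "E.mis \<phi> c = (if ?\<alpha> = c then ?f else {}) \<union> (if ?\<gamma> = c then ?e else {})" if "c \<in> {1..d}" for c
  proof -
    have 1: "proper_coloring (edges R - {?f}) d \<phi>" by (rule proper_coloring_subset[OF proper]) blast
    have "?e \<in> edges R - {?f}" using e fe by blast
    then show ?thesis
      unfolding E_def using missing_remove[OF 1, of ?e "verts R" c] edge_R(1)[OF e(1)]
        missing_remove[OF proper b(3) edge_R(1)[OF b(3)], of c] missing_R[OF that] by simp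
  qed
  have bxy: "b \<notin> ?e"
  proof
    \<comment> \<open>In this case \<open>b\<close> misses the colours of both deleted edges, which
      differ, while \<open>v\<close> misses the colour of \<open>v b\<close>.\<close>
    assume be: "b \<in> ?e"
    then have "?\<alpha> \<noteq> ?\<gamma>" using proper_coloringD[OF proper b(3) e(1), of b] fe by blast
    then show False using NC[OF prE ag] m0[OF ag(1)] m0[OF ag(2)] be by auto
  qed
  have dist: "distinct [v, b, x, y]" using bxy e(2) b(2) xy by auto
  \<comment> \<open>Normalisation: all four ends of the deleted edges should miss one colour. If the
    two colours differ, a chain from \<open>v\<close> to \<open>x\<close> or \<open>y\<close> could
    be exchanged to separate \<open>v\<close> from \<open>b\<close>; hence \<open>x\<close> and
    \<open>y\<close> are linked, and their chain is exchanged.\<close>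
  obtain \<chi> \<alpha> where \<chi>: "proper_coloring E d \<chi>" "\<alpha> \<in> {1..d}" "E.mis \<chi> \<alpha> = {v, b, x, y}"
    and \<chi>0: "\<And>c. c \<in> {1..d} \<Longrightarrow> c \<noteq> \<alpha> \<Longrightarrow> E.mis \<chi> c = {}"
  proof (cases "?\<alpha> = ?\<gamma>")
    case True
    have "E.mis \<phi> ?\<alpha> = {v, b, x, y}" using m0[OF ag(1)] True by auto
    moreover have "E.mis \<phi> c = {}" if "c \<in> {1..d}" "c \<noteq> ?\<alpha>" for c
      using m0[OF that(1)] that(2) True by auto
    ultimately show thesis using that prE ag by blast
  next
    case False
    have ma: "E.mis \<phi> ?\<alpha> = ?f" using m0[OF ag(1)] False by auto
    have mg: "E.mis \<phi> ?\<gamma> = ?e" using m0[OF ag(2)] False by auto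
    have D: "(E.mis \<phi> ?\<alpha> - E.mis \<phi> ?\<gamma>) \<union> (E.mis \<phi> ?\<gamma> - E.mis \<phi> ?\<alpha>) = {v, b, x, y}"
      unfolding ma mg using dist by auto
    have bad: False if z: "z \<in> E.kcomp \<phi> ?\<alpha> ?\<gamma> v" "z \<in> {x, y}" for z
    proof -
      have zD: "v \<in> {v, b, x, y}" "z \<in> {v, b, x, y}" "z \<noteq> v" using z dist by auto
      show False
      proof (rule E.kempe_exchange[OF prE False ag D zD z(1)])
        fix \<chi> assume 1: "proper_coloring E d \<chi>"
          "E.mis \<chi> ?\<alpha> = (E.mis \<phi> ?\<alpha> - {v, z}) \<union> ({v, z} - E.mis \<phi> ?\<alpha>)"
          "E.mis \<chi> ?\<gamma> = (E.mis \<phi> ?\<gamma> - {v, z}) \<union> ({v, z} - E.mis \<phi> ?\<gamma>)"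
        have "b \<in> E.mis \<chi> ?\<alpha>" "v \<in> E.mis \<chi> ?\<gamma>" unfolding 1(2,3) ma mg using z dist by auto
        then show False using NC[OF 1(1) ag(2,1)] False[symmetric] by blast
      qed
    qed
    have lk: "y \<in> E.kcomp \<phi> ?\<alpha> ?\<gamma> x"
      using E.kempe_pairing[OF prE False D dist] bad by blast
    have xD: "x \<in> {v, b, x, y}" "y \<in> {v, b, x, y}" "y \<noteq> x" using xy by auto
    show thesis
    proof (rule E.kempe_exchange[OF prE False ag D xD lk])
      fix \<chi> assume 1: "proper_coloring E d \<chi>"
        "E.mis \<chi> ?\<alpha> = (E.mis \<phi> ?\<alpha> - {x, y}) \<union> ({x, y} - E.mis \<phi> ?\<alpha>)"
        "E.mis \<chi> ?\<gamma> = (E.mis \<phi> ?\<gamma> - {x, y}) \<union> ({x, y} - E.mis \<phi> ?\<gamma>)"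
        and 2: "\<And>c. c \<notin> {?\<alpha>, ?\<gamma>} \<Longrightarrow> E.mis \<chi> c = E.mis \<phi> c"
      have "E.mis \<chi> ?\<alpha> = {v, b, x, y}" unfolding 1(2) ma using dist by auto
      moreover have "E.mis \<chi> c = {}" if c: "c \<in> {1..d}" "c \<noteq> ?\<alpha>" for c
      proof (cases "c = ?\<gamma>")
        case True
        then show ?thesis using 1(3) unfolding mg by simp
      next
        case False
        then show ?thesis using 2[of c] m0[OF c(1)] c(2) by auto
      qed
      ultimately show thesis using that 1(1) ag(1) by blast
    qed
  qed
  \<comment> \<open>Recolouring such an edge with \<open>\<alpha>\<close> frees its old colour at
    \<open>p\<close>, whereas the other one of \<open>v\<close>, \<open>b\<close> still misses
    \<open>\<alpha>\<close>.\<close>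
  have noadj: "{p, z} \<notin> edges R" if p: "p \<in> {v, b}" and z: "z \<in> {x, y}" for p z
  proof
    assume pz: "{p, z} \<in> edges R"
    have E: "{p, z} \<in> E" unfolding E_def using pz p z dist by (auto simp: doubleton_eq_iff)
    let ?\<beta> = "\<chi> {p, z}"
    have \<beta>: "?\<beta> \<in> {1..d}" using proper_coloring_range[OF \<chi>(1) E] .
    have pm: "p \<in> E.mis \<chi> \<alpha>" "z \<in> E.mis \<chi> \<alpha>" using \<chi>(3) p z by auto
    then have ne: "\<alpha> \<noteq> ?\<beta>" using E unfolding missing_def by blast
    note rc = proper_coloring_recolor[OF \<chi>(1) E \<chi>(2) pm]
    consider "p = v" | "p = b" using p by blast
    then show False
    proof cases
      case 1
      have "b \<in> E.mis (\<chi>({p, z} := \<alpha>)) \<alpha>"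
        by (rule missing_recolor) (use \<chi>(3) 1 z dist in auto)
      then show False using NC[OF rc(1) \<beta> \<chi>(2) ne[symmetric]] rc(2) 1 by blast
    next
      case 2
      have "v \<in> E.mis (\<chi>({p, z} := \<alpha>)) \<alpha>"
        by (rule missing_recolor) (use \<chi>(3) 2 z dist in auto)
      then show False using NC[OF rc(1) \<chi>(2) \<beta> ne] rc(2) 2 by blast
    qed
  qed
  obtain w where w: "w \<in> neighbors R v" "w \<in> neighbors R b" "w \<in> neighbors R x"
    and wd: "w \<notin> {v, b, x, y}"
  proof -
    let ?U = "verts R - {v, b, x, y}"
    let ?A = "neighbors R v - {b}" and ?B = "neighbors R b - {v}" and ?C = "neighbors R x - {y}"
    have nb: "t \<in> verts R" "{p, t} \<in> edges R" "t \<noteq> p" if "t \<in> neighbors R p" for p t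
      using that neighbors_neq unfolding neighbors_def by auto
    have vb: "t \<notin> {x, y}" if "t \<in> neighbors R p" "p \<in> {v, b}" for p t
      using nb(2)[OF that(1)] noadj[OF that(2)] by blast
    have x: "t \<notin> {v, b}" if "t \<in> neighbors R x" for t
      using nb(2)[OF that] noadj[of t x] by (auto simp: insert_commute)
    have sub: "?A \<subseteq> ?U" "?B \<subseteq> ?U" "?C \<subseteq> ?U"
      using nb(1,3) vb x by blast+
    have "b \<in> neighbors R v" using N_un N2 by blast
    moreover from this have "v \<in> neighbors R b" using neighbors_sym v by blast
    moreover have "y \<in> neighbors R x" using e xy unfolding neighbors_def by simp
    ultimately have cd: "card ?A = d - 1" "card ?B = d - 1" "card ?C = d - 1"
      using card_neighbors_R v b xy finite_neighbors by simp_all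
    have "{v, b, x, y} \<subseteq> verts R" using v b xy by auto
    then have "card ?U = card (verts R) - 4" "4 \<le> card (verts R)"
      using dist finite_R card_mono[OF finite_R, of "{v, b, x, y}"] by (simp_all add: card_Diff_subset)
    moreover have "d \<ge> 1" using card_N N2_ne finite_N(2) by (simp add: N2)
    \<comment> \<open>Three sets of size \<open>d - 1\<close> lie in a set of size
      \<open>card (verts R) - 4\<close>, and the density bound gives
      \<open>3 * (d - 1) > 2 * (card (verts R) - 4)\<close>.\<close>
    ultimately have "card ?A + card ?B + card ?C > 2 * card ?U" using cd dense by linarith
    then have "?A \<inter> ?B \<inter> ?C \<noteq> {}" using triple_Int_nonempty[OF _ sub] finite_R by blast
    then show thesis using that sub by blast
  qed
  let ?a = "{v, w}" and ?b = "{b, w}" and ?x = "{w, x}"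
  have wR: "?a \<in> E" "?b \<in> E" "?x \<in> E"
    using w wd dist unfolding neighbors_def E_def by (auto simp: doubleton_eq_iff insert_commute)
  have ne: "?a \<noteq> ?b" "?a \<noteq> ?x" "?b \<noteq> ?x" using wd dist by (auto simp: doubleton_eq_iff)
  define F where "F = E - {?a} - {?b} - {?x}"
  interpret F: edge_set "verts R" F by (rule edge_set_R) (auto simp: E_def F_def)
  let ?p = "\<chi> ?a" and ?q = "\<chi> ?b" and ?r = "\<chi> ?x"
  have pqr: "?p \<in> {1..d}" "?q \<in> {1..d}" "?r \<in> {1..d}" using proper_coloring_range[OF \<chi>(1)] wR by auto
  have cd: "distinct [\<alpha>, ?p, ?q, ?r]"
  proof -
    have "?p \<noteq> ?q" "?p \<noteq> ?r" "?q \<noteq> ?r"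
      using proper_coloringD[OF \<chi>(1), of _ _ w] wR ne by blast+
    moreover have "?p \<noteq> \<alpha>" "?q \<noteq> \<alpha>" "?r \<noteq> \<alpha>"
      using missing_disjoint_edge[of _ "verts R" E \<chi> \<alpha>] \<chi>(3) wR by blast+
    ultimately show ?thesis by auto
  qed
  have mF: "F.mis \<chi> c = E.mis \<chi> c \<union> (if ?p = c then ?a else {}) \<union> (if ?q = c then ?b else {}) \<union>
      (if ?r = c then ?x else {})" for c
  proof -
    have 1: "proper_coloring (E - {?a}) d \<chi>" "proper_coloring (E - {?a} - {?b}) d \<chi>"
      by (rule proper_coloring_subset[OF \<chi>(1)]; blast)+
    have 2: "?b \<in> E - {?a}" "?x \<in> E - {?a} - {?b}" using wR ne by auto
    show ?thesis unfolding F_def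
      using missing_remove[OF \<chi>(1) wR(1) E.edge_sub[OF wR(1)]]
        missing_remove[OF 1(1) 2(1) E.edge_sub[OF wR(2)]]
        missing_remove[OF 1(2) 2(2) E.edge_sub[OF wR(3)]] by simp
  qed
  have k0: "F.mis \<chi> \<alpha> = {v, b, x, y}" using mF[of \<alpha>] \<chi>(3) cd by auto
  have k1: "F.mis \<chi> ?p = {v, w}" using mF[of ?p] \<chi>0[OF pqr(1)] cd by auto
  have k2: "F.mis \<chi> ?q = {b, w}" using mF[of ?q] \<chi>0[OF pqr(2)] cd by auto
  have k3: "F.mis \<chi> ?r = {x, w}" using mF[of ?r] \<chi>0[OF pqr(3)] cd by auto
  have prF: "proper_coloring F d \<chi>"
    by (rule proper_coloring_subset[OF \<chi>(1)]) (auto simp: F_def)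
  have dist5: "distinct [v, b, x, y, w]" using dist wd by auto
  have cr: "{\<alpha>, ?p, ?q, ?r} \<subseteq> {1..d}" using pqr \<chi>(2) by auto
  \<comment> \<open>The three edges at \<open>w\<close> are put back one by one with colours
    \<open>p\<close>, \<open>q\<close>, \<open>r\<close>; then \<open>v\<close> still misses
    \<open>s\<close> and \<open>b\<close> still misses \<open>t\<close>, contrary to
    \<open>NC\<close>.\<close>
  have noF: False if "proper_coloring F d \<theta>" and k: "{p, q, r, s, t} \<subseteq> {1..d}"
      and pq: "distinct [p, q, r]" "s \<noteq> p" "t \<noteq> q" "s \<noteq> t"
      and mm: "{v, w} \<subseteq> F.mis \<theta> p" "{b, w} \<subseteq> F.mis \<theta> q" "{w, x} \<subseteq> F.mis \<theta> r"
        "v \<in> F.mis \<theta> s" "b \<in> F.mis \<theta> t" for \<theta> p q r s t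
  proof -
    let ?F1 = "insert ?a F" and ?\<theta>1 = "\<theta>(?a := p)"
    let ?F2 = "insert ?b ?F1" and ?\<theta>2 = "?\<theta>1(?b := q)"
    let ?F3 = "insert ?x ?F2" and ?\<theta>3 = "?\<theta>2(?x := r)"
    have nF: "?a \<notin> F" "?b \<notin> ?F1" "?x \<notin> ?F2" using ne by (auto simp: F_def)
    have wv: "w \<noteq> v" "w \<noteq> b" "w \<noteq> x" "v \<noteq> b" "v \<noteq> x" "b \<noteq> x" using wd dist by auto
    have p1: "proper_coloring ?F1 d ?\<theta>1"
      by (rule proper_coloring_insert_missing[OF that(1) nF(1)]) (use k mm in auto)
    have b1: "b \<in> missing (verts R) ?F1 ?\<theta>1 q" "w \<in> missing (verts R) ?F1 ?\<theta>1 q"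
      by (rule missing_insert; use mm wv pq in auto)+
    have x1: "x \<in> missing (verts R) ?F1 ?\<theta>1 r" "w \<in> missing (verts R) ?F1 ?\<theta>1 r"
      by (rule missing_insert; use mm wv pq in auto)+
    have s1: "v \<in> missing (verts R) ?F1 ?\<theta>1 s" "b \<in> missing (verts R) ?F1 ?\<theta>1 t"
      by (rule missing_insert; use mm wv pq in auto)+
    have p2: "proper_coloring ?F2 d ?\<theta>2"
      by (rule proper_coloring_insert_missing[OF p1 nF(2) _ b1]) (use k in auto)
    have x2: "x \<in> missing (verts R) ?F2 ?\<theta>2 r" "w \<in> missing (verts R) ?F2 ?\<theta>2 r"
      by (rule missing_insert; use x1 wv pq in auto)+
    have s2: "v \<in> missing (verts R) ?F2 ?\<theta>2 s" "b \<in> missing (verts R) ?F2 ?\<theta>2 t"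
      by (rule missing_insert; use s1 wv pq in auto)+
    have p3: "proper_coloring ?F3 d ?\<theta>3"
      by (rule proper_coloring_insert_missing[OF p2 nF(3) _ x2(2) x2(1)]) (use k in auto)
    have s3: "v \<in> missing (verts R) ?F3 ?\<theta>3 s" "b \<in> missing (verts R) ?F3 ?\<theta>3 t"
      by (rule missing_insert; use s2 wv pq in auto)+
    have "?F3 = E" using wR by (auto simp: F_def)
    then show False using NC[of ?\<theta>3 s t] p3 s3 k pq by simp
  qed
  show False by (rule F.no_short_kite[OF prF dist5 cd cr k0 k1 k2 k3 noF])
qed

section \<open>Criticality and chromatic index of \<open>G\<close>\<close>

lemma critical:
  assumes e: "e \<in> edges G" and dense: "2 * card (verts R) \<le> 3 * d + 2"
  shows "\<exists>\<chi>. proper_coloring (edges G - {e}) d \<chi>"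
proof (cases "e = {v1, v2}")
  case True
  then have "edges G - {e} \<subseteq> core" using edges_G_core by blast
  then show ?thesis using proper_coloring_subset[OF proper_core] by blast
next
  case False
  then have "e \<in> core" using e edges_G_core by blast
  then show ?thesis
  proof (cases rule: core_cases)
    case (one u)
    then show ?thesis using critical_at_v1 by simp
  next
    case (two u)
    then show ?thesis using splitting.critical_at_v1[OF flip] by simp
  next
    case old
    then obtain x y where xy: "e = {x, y}" using edge_R(2)[of e] by (auto simp: card_2_iff)
    have "card N1 > 0" "card N2 > 0" using finite_N N1_ne N2_ne by (auto simp: card_gt_0_iff)
    \<comment> \<open>The edge \<open>v1 v2\<close> adds one to each degree, so the cases are
      degrees at least 3 at both new vertices, or degree 2 at one of them.\<close>
    then consider "card N1 \<ge> 2" "card N2 \<ge> 2" | "card N2 = 1" | "card N1 = 1" by linarith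
    then show ?thesis
    proof cases
      case 1
      then show ?thesis using critical_large dense old xy by simp
    next
      case 2
      then obtain b where "N2 = {b}" by (auto simp: card_1_singleton_iff)
      then show ?thesis using critical_subdivision dense old xy by simp
    next
      case 3
      then obtain b where "N1 = {b}" by (auto simp: card_1_singleton_iff)
      then show ?thesis using splitting.critical_subdivision[OF flip] dense old xy by simp
    qed
  qed
qed

lemma chromatic_index_G: "chromatic_index G = d + 1"
  unfolding chromatic_index_def
proof (rule Least_equality)
  have "proper_coloring core (d + 1) \<psi>" using proper_core unfolding proper_coloring_def by auto
  moreover have "\<psi> e \<noteq> d + 1" if "e \<in> core" for e
    using proper_coloring_range[OF proper_core that] by auto
  ultimately have "proper_coloring (insert {v1, v2} core) (d + 1) (\<psi>({v1, v2} := d + 1))"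
    using split_edge_notin_core by (intro proper_coloring_insert) auto
  then show "\<exists>\<phi>. edge_coloring G (d + 1) \<phi>" unfolding edge_coloring_iff edges_G_core by blast
next
  fix k assume "\<exists>\<phi>. edge_coloring G k \<phi>"
  then obtain \<chi> where \<chi>: "proper_coloring (edges G) k \<chi>" unfolding edge_coloring_iff by blast
  show "d + 1 \<le> k"
  proof (rule ccontr)
    assume "\<not> d + 1 \<le> k"
    then have "proper_coloring (edges G) d \<chi>" using \<chi> unfolding proper_coloring_def by auto
    then show False using no_coloring_G by blast
  qed
qed

text \<open>Ensures that a proper subgraph of \<open>G\<close> lacks an edge and not merely a
  vertex.\<close>

lemma not_isolated:
  assumes "u \<in> verts G"
  shows "\<exists>e\<in>edges G. u \<in> e"
proof -
  consider "u = v1" | "u = v2" | "u \<in> verts R" "u \<noteq> v" using assms unfolding verts_G by blast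
  then show ?thesis
  proof cases
    case 3
    then have "card {e \<in> edges G. u \<in> e} = d" using degree_old unfolding degree_def by blast
    moreover have "d > 0" using card_N N1_ne finite_N by (auto simp: card_gt_0_iff)
    ultimately have "{e \<in> edges G. u \<in> e} \<noteq> {}" by (metis card.empty less_irrefl)
    then show ?thesis by blast
  qed (use edges_G_core in auto)
qed

lemma delta_critical_G:
  assumes dense: "2 * card (verts R) \<le> 3 * d + 2"
  shows "delta_critical d G"
  unfolding delta_critical_def edge_chromatic_critical_def
proof (intro conjI allI impI)
  show "max_degree G = d" by (rule max_degree_G)
  show "chromatic_index G = d + 1" by (rule chromatic_index_G)
  fix H assume H: "subgraph H G \<and> H \<noteq> G"
  then have sub: "simple_graph H" "verts H \<subseteq> verts G" "edges H \<subseteq> edges G"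
    unfolding subgraph_def by auto
  have "edges H \<noteq> edges G"
  proof
    assume eq: "edges H = edges G"
    have "verts G \<subseteq> verts H"
    proof
      fix u assume "u \<in> verts G"
      then obtain e where "e \<in> edges H" "u \<in> e" using not_isolated eq by blast
      then show "u \<in> verts H" using sub(1) unfolding simple_graph_def by blast
    qed
    then have "H = G" using eq sub(2) by (intro ugraph.equality) auto
    then show False using H by blast
  qed
  then obtain e where e: "e \<in> edges G" "edges H \<subseteq> edges G - {e}" using sub(3) by blast
  then obtain \<chi> where "proper_coloring (edges G - {e}) d \<chi>" using critical dense by blast
  then have "edge_coloring H d \<chi>"
    unfolding edge_coloring_iff using proper_coloring_subset e(2) by blast
  then have "chromatic_index H \<le> d" unfolding chromatic_index_def by (intro Least_le) blast
  then show "chromatic_index H < chromatic_index G" unfolding chromatic_index_G by simp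
qed

end

lemma splitting_of_vertex_splitting:
  assumes "simple_graph R" "regular d R" "proper_coloring (edges R) d \<phi>" "vertex_splitting R v G"
  shows "\<exists>v1 v2 N1 N2. splitting R G v v1 v2 N1 N2 d \<phi>"
  using assms unfolding vertex_splitting_def splitting_def
  by (elim conjE exE) (intro exI conjI; assumption)

theorem theorem1:
  fixes n \<Delta> :: nat and R G :: "'a ugraph" and v :: 'a
  assumes "n > 0" and "\<Delta> > 0"
    and "real \<Delta> \<ge> (2 * real n - 4) / 3"
    and "simple_graph R" and "card (verts R) = n - 1"
    and "connected_graph R" and "regular \<Delta> R" and "class1 R"
    and "simple_graph G" and "card (verts G) = n"
    and "vertex_splitting R v G"
  shows "delta_critical \<Delta> G"
proof -
  have v: "v \<in> verts R" using assms(11) unfolding vertex_splitting_def by (rule conjunct1)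
  have "degree R ` verts R = {\<Delta>}" using assms(7) v unfolding regular_def by auto
  then have "max_degree R = \<Delta>" unfolding max_degree_def by simp
  then have ci: "chromatic_index R = \<Delta>" using assms(8) unfolding class1_def by simp
  have "\<exists>k \<phi>. edge_coloring R k \<phi>"
    using proper_coloring_exists[OF assms(4)] unfolding edge_coloring_iff .
  then have "\<exists>\<phi>. edge_coloring R (chromatic_index R) \<phi>"
    unfolding chromatic_index_def by (rule LeastI_ex)
  then obtain \<phi> where \<phi>: "proper_coloring (edges R) \<Delta> \<phi>" unfolding ci edge_coloring_iff by blast
  obtain v1 v2 N1 N2 where "splitting R G v v1 v2 N1 N2 \<Delta> \<phi>"
    using splitting_of_vertex_splitting[OF assms(4,7) \<phi> assms(11)] by blast
  then interpret splitting R G v v1 v2 N1 N2 \<Delta> \<phi> .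
  have "2 * real n - 4 \<le> 3 * real \<Delta>" using assms(3) by (simp add: field_simps)
  \<comment> \<open>Since \<open>R\<close> has \<open>n - 1\<close> vertices,
    \<open>2 * n - 4\<close> equals \<open>2 * card (verts R) - 2\<close>.\<close>
  then have "2 * card (verts R) \<le> 3 * \<Delta> + 2" using assms(1,5) by simp
  then show ?thesis by (rule delta_critical_G)
qed

end
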